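(* Let $P,Q\in\mathbb Z$ with $Q=\pm1$ and $\Delta=P^2+4Q>0$, and assume the Lucas sequence $U_n=U_n(P,Q)$ is nondegenerate. Assume the $abc$ conjecture over $K=\mathbb Q(\sqrt\Delta)$. Fix $A\in\mathbb Z\setminus\{0\}$ and put $$T(P,Q,A)=\{n\ge2:[U_n(P,Q)]\in G_A\}.$$ Then $T(P,Q,A)$ is finite. Moreover, for every $r\ge1$ and all positive integers $n_1,\ldots,n_r$ with $\gcd(n_i,n_j)=1$ for $i\neq j$ such that $$Ay^2=\prod_{i=1}^r U_{n_i}(P,Q)$$ for some $y\in\mathbb Z$: after deleting the trivial factors $U_1=1$ (i.e. the indices $n_i=1$), all remaining indices lie in $T(P,Q,A)$, and they form a clique in the coprimality graph on $T(P,Q,A)$. The remaining conditions are the square-class compatibility condition and the integrality condition; that is, for pairwise coprime indices $n_1,\dots,n_r$ whose nontrivial members form a clique in this graph, the equation has a solution $y\in\mathbb Z$ if and only if $$\prod_i [U_{n_i}]=[A]\quad\text{in }\mathbb Q^\times/(\mathbb Q^\times)^2$$ and $\sum_{i} v_p(U_{n_i})-v_p(A)\in 2\mathbb Z_{\ge0}$ for every rational prime $p$.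
   Context: The Lucas sequence $U_n=U_n(P,Q)$ is defined by $U_0=0$, $U_1=1$, $U_{n+2}=PU_{n+1}+QU_n$. Let $\alpha,\beta$ be the roots of $x^2-Px-Q$. The sequence is nondegenerate if $\alpha/\beta$ is not a root of unity (then $U_n\neq0$ for $n\ge1$, and $K=\mathbb Q(\sqrt\Delta)$ is a real quadratic field). $[x]$ denotes the class of $x$ in $\mathbb Q^\times/(\mathbb Q^\times)^2$, and $G_A=\langle -1,\ p:p\mid A\rangle\subseteq\mathbb Q^\times/(\mathbb Q^\times)^2$ ($p$ running over rational primes dividing $A$). The coprimality graph on $T(P,Q,A)$ has vertex set $T(P,Q,A)$, with an edge joining two vertices when they are coprime integers. $v_p$ is the $p$-adic valuation. The $abc$ conjecture over $K$: for every $\varepsilon>0$ there is a constant $C_{K,\varepsilon}$ such that for all triples $(a,b,c)$ of nonzero elements of $K$ with $a+b=c$, $$h(a:b:c)\le(1+\varepsilon)\operatorname{rad}_K(a:b:c)+C_{K,\varepsilon}.$$ Here $h(a:b:c)=\frac1{[K:\mathbb Q]}\sum_v\log\max\{|a|_v,|b|_v,|c|_v\}$, summed over all places $v$ of $K$, with absolute values normalised to satisfy the product formula ($|x|_v=|\sigma(x)|$ for a real embedding $\sigma$, $|x|_{\mathfrak p}=(N\mathfrak p)^{-v_{\mathfrak p}(x)}$ for a nonzero prime ideal $\mathfrak p$ of $\mathcal O_K$, $N\mathfrak p=|\mathcal O_K/\mathfrak p|$); and $\operatorname{rad}_K(a:b:c)=\frac1{[K:\mathbb Q]}\sum_{\mathfrak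 p\in I(a,b,c)}\log N\mathfrak p$, where $I(a,b,c)$ is the set of nonzero prime ideals $\mathfrak p$ for which $v_{\mathfrak p}(a),v_{\mathfrak p}(b),v_{\mathfrak p}(c)$ are not all equal. *)

theory Defs
  imports
    "HOL-Algebra.Algebra"
    "HOL-Algebra.Algebraic_Closure_Type"
    "HOL-Analysis.Analysis"
    "HOL-Library.Ramsey"
begin

section \<open>Lucas sequences\<close>

fun lucas_U :: "int \<Rightarrow> int \<Rightarrow> nat \<Rightarrow> int" where
  "lucas_U P Q 0 = 0"
| "lucas_U P Q (Suc 0) = 1"
| "lucas_U P Q (Suc (Suc n)) = P * lucas_U P Q (Suc n) + Q * lucas_U P Q n"

definition lucas_nondegenerate :: "int \<Rightarrow> int \<Rightarrow> bool" where
  "lucas_nondegenerate P Q \<longleftrightarrow>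
     (\<forall>\<alpha> \<beta> :: complex.
        (\<forall>x. x\<^sup>2 - of_int P * x - of_int Q = (x - \<alpha>) * (x - \<beta>)) \<longrightarrow>
        \<not> (\<exists>k::nat. k > 0 \<and> (\<alpha> / \<beta>) ^ k = 1))"


section \<open>Square classes of rational numbers\<close>

abbreviation rat_units :: "rat monoid" where
  "rat_units \<equiv> Multiplicative_Group.mult_of (ring_of_type_algebra :: rat ring)"

definition nonzero_squares :: "rat set" where
  "nonzero_squares = (\<lambda>x. x\<^sup>2) ` carrier rat_units"

definition sqclass_group :: "rat set monoid" where
  "sqclass_group = rat_units Mod nonzero_squares"

definition sqclass :: "rat \<Rightarrow> rat set" where
  "sqclass x = nonzero_squares #>\<^bsub>rat_units\<^esub> x"

definition G_group :: "int \<Rightarrow> rat set set" where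
  "G_group A = generate sqclass_group
     (insert (sqclass (-1)) {sqclass (of_int p) | p. Factorial_Ring.prime p \<and> p dvd A})"


section \<open>The index set and its coprimality graph\<close>

definition T_set :: "int \<Rightarrow> int \<Rightarrow> int \<Rightarrow> nat set" where
  "T_set P Q A = {n. n \<ge> 2 \<and> sqclass (of_int (lucas_U P Q n)) \<in> G_group A}"

definition coprimality_edges :: "nat set \<Rightarrow> nat set set" where
  "coprimality_edges V = {{m, n} | m n. m \<in> V \<and> n \<in> V \<and> m \<noteq> n \<and> coprime m n}"

definition is_coprimality_clique :: "nat set \<Rightarrow> nat set \<Rightarrow> bool" where
  "is_coprimality_clique V C \<longleftrightarrow> C \<subseteq> V \<and> clique C (coprimality_edges V)"


section \<open>Heights, radicals and the abc conjecture over a number field\<close>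

text \<open>
  Number fields are sets of real numbers here. The height below uses only real infinite
  places, so it is the usual one exactly for totally real fields, in particular for real
  quadratic fields.
\<close>

definition subring_of_reals :: "real set \<Rightarrow> real ring" where
  "subring_of_reals S = (ring_of_type_algebra :: real ring)\<lparr>carrier := S\<rparr>"

definition quadratic_field :: "int \<Rightarrow> real set" where
  "quadratic_field d =
     generate_field (ring_of_type_algebra :: real ring) {sqrt (of_int d)}"

definition field_degree :: "real set \<Rightarrow> nat" where
  "field_degree K = vector_space.dim (\<lambda>(q::rat) (x::real). of_rat q * x) K"

definition ring_of_ints :: "real set \<Rightarrow> real ring" where
  "ring_of_ints K = subring_of_reals {x \<in> K. algebraic_int x}"

text \<open>Maps are made extensional so that each embedding of \<open>K\<close> is counted once.\<close>

definition real_embeddings :: "real set \<Rightarrow> (real \<Rightarrow> real) set" where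
  "real_embeddings K =
     ring_hom (subring_of_reals K) (subring_of_reals UNIV) \<inter> extensional K"

definition finite_places :: "real set \<Rightarrow> real set set" where
  "finite_places K = {\<pp>. primeideal \<pp> (ring_of_ints K) \<and> \<pp> \<noteq> {0}}"

definition ideal_norm :: "real set \<Rightarrow> real set \<Rightarrow> nat" where
  "ideal_norm K \<pp> = card (carrier (ring_of_ints K Quot \<pp>))"

definition integral_valuation :: "real set \<Rightarrow> real set \<Rightarrow> real \<Rightarrow> nat" where
  "integral_valuation K \<pp> x =
     (GREATEST k::nat. x \<in> \<pp> [^]\<^bsub>ideals_set (ring_of_ints K)\<^esub> k)"

text \<open>
  Every nonzero element of \<open>K\<close> is a quotient of two nonzero integers of \<open>K\<close>, and the
  difference of valuations does not depend on the quotient chosen.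
\<close>

definition valuation :: "real set \<Rightarrow> real set \<Rightarrow> real \<Rightarrow> int" where
  "valuation K \<pp> x =
     (SOME m. \<exists>a\<in>carrier (ring_of_ints K). \<exists>b\<in>carrier (ring_of_ints K).
        a \<noteq> 0 \<and> b \<noteq> 0 \<and> x = a / b \<and>
        m = int (integral_valuation K \<pp> a) - int (integral_valuation K \<pp> b))"

definition finite_abs :: "real set \<Rightarrow> real set \<Rightarrow> real \<Rightarrow> real" where
  "finite_abs K \<pp> x =
     (if x = 0 then 0 else real (ideal_norm K \<pp>) powi (- valuation K \<pp> x))"

text \<open>
  For nonzero \<open>a\<close>, \<open>b\<close>, \<open>c\<close> only finitely many finite places contribute a nonzero term
  to the infinite sum, and the set of places defining the radical is finite.
\<close>

definition abc_height :: "real set \<Rightarrow> real \<Rightarrow> real \<Rightarrow> real \<Rightarrow> real" where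
  "abc_height K a b c =
     1 / real (field_degree K) *
       ((\<Sum>\<sigma>\<in>real_embeddings K. ln (Max {\<bar>\<sigma> a\<bar>, \<bar>\<sigma> b\<bar>, \<bar>\<sigma> c\<bar>})) +
        (\<Sum>\<^sub>\<infinity>\<pp>\<in>finite_places K.
           ln (Max {finite_abs K \<pp> a, finite_abs K \<pp> b, finite_abs K \<pp> c})))"

definition abc_support :: "real set \<Rightarrow> real \<Rightarrow> real \<Rightarrow> real \<Rightarrow> real set set" where
  "abc_support K a b c =
     {\<pp> \<in> finite_places K.
        \<not> (valuation K \<pp> a = valuation K \<pp> b \<and> valuation K \<pp> b = valuation K \<pp> c)}"

definition abc_radical :: "real set \<Rightarrow> real \<Rightarrow> real \<Rightarrow> real \<Rightarrow> real" where
  "abc_radical K a b c =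
     1 / real (field_degree K) * (\<Sum>\<pp>\<in>abc_support K a b c. ln (real (ideal_norm K \<pp>)))"

definition abc_conjecture :: "real set \<Rightarrow> bool" where
  "abc_conjecture K \<longleftrightarrow>
     (\<forall>\<epsilon>::real. \<epsilon> > 0 \<longrightarrow>
        (\<exists>C::real. \<forall>a\<in>K - {0}. \<forall>b\<in>K - {0}. \<forall>c\<in>K - {0}.
           a + b = c \<longrightarrow> abc_height K a b c \<le> (1 + \<epsilon>) * abc_radical K a b c + C))"

end

theory Submission
  imports Defs
begin

text \<open>
  Write \<open>\<alpha>\<close>, \<open>\<beta>\<close> for the roots of \<open>x\<^sup>2 - P x - Q\<close>, \<open>w = \<alpha> - \<beta>\<close> for the positive square root of the
  discriminant \<open>\<Delta>\<close>, and \<open>M = max \<bar>\<alpha>\<bar> \<bar>\<beta>\<bar>\<close>. Since \<open>Q = \<plusminus>1\<close>, the roots are units, so \<open>\<bar>\<alpha>\<bar> \<bar>\<beta>\<bar> = 1\<close>;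
  nondegeneracy forces \<open>P \<noteq> 0\<close>, hence \<open>M > 1\<close>, \<open>\<Delta>\<close> is not a square, and \<open>U\<^sub>n \<noteq> 0\<close> for \<open>n > 0\<close>.

  Finiteness of the index set. Every class in the group generated by \<open>-1\<close> and the primes dividing \<open>A\<close>
  is the class of a divisor of \<open>A\<close>, so each index \<open>n\<close> satisfies \<open>d U\<^sub>n = z\<^sup>2\<close> with \<open>d\<close>, \<open>z\<close> integers
  and \<open>0 < \<bar>d\<bar> \<le> \<bar>A\<bar>\<close> (lemma \<open>T_set_square\<close>). The abc conjecture is applied to
  \<open>\<alpha>\<^sup>n + (- \<beta>\<^sup>n) = w U\<^sub>n\<close>. The first two terms are units, so the finite places contribute
  nothing negative to the height, and the two real places give height at least \<open>n ln M\<close>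
  (lemma \<open>abc_height_ge\<close>). A prime in the support of the radical contains \<open>w U\<^sub>n\<close>, hence the rational
  integer \<open>m = \<Delta> \<bar>z\<bar>\<close>. By the Chinese remainder theorem the product of the norms of these primes is at
  most the number of residue classes of the ring of integers modulo \<open>m\<close>, and this number is at most
  \<open>(2 \<Delta> m)\<^sup>2\<close>, because \<open>2 w\<close> times an integer of the field lies in \<open>\<int> + \<int> w\<close>
  (lemmas \<open>residue_eqD\<close>, \<open>prod_ideal_norm_le\<close>, \<open>abc_radical_le\<close>). So the radical is at most
  \<open>ln (2 \<Delta>\<^sup>2 \<bar>z\<bar>)\<close>. As \<open>z\<^sup>2 = d U\<^sub>n\<close> is at most a constant times \<open>M\<^sup>n\<close>, the radical is at most
  \<open>(n / 2) ln M\<close> up to a constant, and the conjecture with \<open>\<epsilon> = 1/2\<close> bounds \<open>n\<close>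
  (lemma \<open>abc_imp_square_class_index_bounded\<close>).

  The clique. Coprime indices have coprime Lucas numbers (lemma \<open>coprime_lucas_U\<close>). If a product of
  pairwise coprime \<open>U\<^bsub>n i\<^esub>\<close> equals \<open>A y\<^sup>2\<close>, a prime not dividing \<open>A\<close> therefore divides at most
  one factor, and to an even power. Each factor thus has its class in the group attached to \<open>A\<close>
  (lemma \<open>even_multiplicity_imp_G_group\<close>).

  The criterion. Equality of square classes says that the product is \<open>A q\<^sup>2\<close> with \<open>q\<close> rational, and
  the inequalities between valuations say that \<open>A\<close> divides the product, so that \<open>q\<^sup>2\<close>, and hence \<open>q\<close>,
  is an integer (lemma \<open>square_product_iff\<close>).
\<close>

section \<open>Real quadratic fields\<close>

lemma ring_of_type_simps [simp]:
  "carrier (ring_of_type_algebra :: 'a::ring_1 ring) = UNIV"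
  "monoid.mult (ring_of_type_algebra :: 'a::ring_1 ring) = (*)"
  "ring.add (ring_of_type_algebra :: 'a::ring_1 ring) = (+)"
  "monoid.one (ring_of_type_algebra :: 'a::ring_1 ring) = 1"
  "ring.zero (ring_of_type_algebra :: 'a::ring_1 ring) = 0"
  by (simp_all add: ring_of_type_algebra_def)

lemma a_inv_real: "\<ominus>\<^bsub>(ring_of_type_algebra :: real ring)\<^esub> x = - x"
proof -
  interpret R: Ring.field "ring_of_type_algebra :: real ring" by (rule field_from_type_algebra)
  show ?thesis using R.minus_equality[of "-x" x] by simp
qed

lemma m_inv_real: "x \<noteq> 0 \<Longrightarrow> inv\<^bsub>(ring_of_type_algebra :: real ring)\<^esub> x = inverse x"
proof -
  assume "x \<noteq> 0"
  interpret R: Ring.field "ring_of_type_algebra :: real ring" by (rule field_from_type_algebra)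
  show ?thesis using R.inv_unique'[of x "inverse x"] \<open>x \<noteq> 0\<close> by simp
qed

text \<open>
  The field \<open>\<rat>(\<surd>D)\<close> with \<open>D > 0\<close> not a square, as a subfield \<open>K\<close> of the reals. Throughout, \<open>w\<close> is
  the positive square root of \<open>D\<close>, and elements are handled through their rational coordinates with
  respect to \<open>1, w\<close>.
\<close>

locale real_quadratic_field =
  fixes D :: int
  assumes D_pos: "D > 0" and sqrt_irrational: "sqrt (of_int D) \<notin> \<rat>"
begin

abbreviation w :: real where "w \<equiv> sqrt (of_int D)"
abbreviation K :: "real set" where "K \<equiv> quadratic_field D"

lemma w_sq: "w * w = of_int D"
  using D_pos by simp

lemma w_pos: "w > 0"
  using D_pos by simp

lemma coordinates_eq_iff:
  "of_rat u + of_rat v * w = of_rat u' + of_rat v' * w \<longleftrightarrow> u = u' \<and> v = v'"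
proof
  assume *: "of_rat u + of_rat v * w = of_rat u' + of_rat v' * w"
  have "v = v'"
  proof (rule ccontr)
    assume "v \<noteq> v'"
    then have "w = of_rat ((u' - u) / (v - v'))"
      using * by (simp add: of_rat_divide of_rat_diff field_simps)
    then show False using sqrt_irrational by simp
  qed
  then show "u = u' \<and> v = v'" using * by simp
qed auto

lemma coordinates_eq_0_iff: "of_rat u + of_rat v * w = 0 \<longleftrightarrow> u = 0 \<and> v = 0"
  using coordinates_eq_iff[of u v 0 0] by simp

lemma coordinates_mult:
  "(of_rat u + of_rat v * w) * (of_rat u' + of_rat v' * w) =
     of_rat (u * u' + of_int D * v * v') + of_rat (u * v' + v * u') * w"
  using w_sq by (simp add: of_rat_add of_rat_mult algebra_simps) 

lemma coordinates_inverse: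
  assumes "x = of_rat u + of_rat v * w" "x \<noteq> 0"
  shows "inverse x = of_rat (u / (u\<^sup>2 - of_int D * v\<^sup>2)) + of_rat (- v / (u\<^sup>2 - of_int D * v\<^sup>2)) * w"
proof -
  define e where "e = u\<^sup>2 - of_int D * v\<^sup>2"
  have prod: "x * (of_rat u + of_rat (- v) * w) = of_rat e"
    unfolding assms(1) coordinates_mult e_def by (simp add: power2_eq_square algebra_simps)
  have "of_rat u + of_rat (- v) * w \<noteq> 0"
    using assms coordinates_eq_0_iff[of u "-v"] by auto
  then have e0: "e \<noteq> 0" using prod assms(2) by auto
  have "x * (of_rat (u / e) + of_rat (- v / e) * w) = 1"
    using prod e0 by (simp add: of_rat_divide of_rat_minus field_simps)
  then show ?thesis unfolding e_def[symmetric] using assms(2) by (simp add: field_simps)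
qed

lemma of_rat_in_K: "of_rat q \<in> K"
proof -
  let ?R = "ring_of_type_algebra :: real ring"
  have one: "1 \<in> generate_field ?R {w}" using generate_field.one[of ?R "{w}"] by simp
  have add: "x + y \<in> generate_field ?R {w}" if "x \<in> generate_field ?R {w}" "y \<in> generate_field ?R {w}" for x y
    using generate_field.eng_add[OF that] by simp
  have mult: "x * y \<in> generate_field ?R {w}" if "x \<in> generate_field ?R {w}" "y \<in> generate_field ?R {w}" for x y
    using generate_field.eng_mult[OF that] by simp
  have neg: "-x \<in> generate_field ?R {w}" if "x \<in> generate_field ?R {w}" for x
    using generate_field.a_inv[OF that] by (simp add: a_inv_real)
  have zero: "0 \<in> generate_field ?R {w}" using add[OF one neg[OF one]] by simp
  have inv: "inverse x \<in> generate_field ?R {w}" if "x \<in> generate_field ?R {w}" for x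
    using generate_field.m_inv[OF that] zero by (cases "x = 0") (auto simp: m_inv_real)
  have nat: "of_nat n \<in> generate_field ?R {w}" for n
    by (induction n) (auto intro: zero add one)
  have int: "of_int k \<in> generate_field ?R {w}" for k
    by (cases k) (use nat neg in \<open>auto simp del: of_nat_Suc\<close>)
  obtain a b where "q = of_int a / of_int b" by (metis Fract_of_int_quotient Rat_cases)
  then have "of_rat q = (of_int a * inverse (of_int b) :: real)"
    by (simp add: of_rat_divide divide_inverse[symmetric])
  then show ?thesis unfolding quadratic_field_def using mult[OF int inv[OF int]] by simp
qed

lemma quadratic_field_eq: "K = {of_rat u + of_rat v * w | u v. True}"
proof (intro equalityI subsetI)
  let ?R = "ring_of_type_algebra :: real ring"
  fix x assume "x \<in> K"
  then have "x \<in> generate_field ?R {w}" by (simp add: quadratic_field_def)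
  then show "x \<in> {of_rat u + of_rat v * w | u v. True}"
  proof induction
    case one
    have "\<one>\<^bsub>?R\<^esub> = of_rat 1 + of_rat 0 * w" by simp
    then show ?case by blast
  next
    case (incl h)
    then have "h = of_rat 0 + of_rat 1 * w" by simp
    then show ?case by blast
  next
    case (a_inv h)
    then obtain u v where "h = of_rat u + of_rat v * w" by auto
    then have "\<ominus>\<^bsub>?R\<^esub> h = of_rat (-u) + of_rat (-v) * w" by (simp add: a_inv_real of_rat_minus)
    then show ?case by blast
  next
    case (m_inv h)
    then obtain u v where "h = of_rat u + of_rat v * w" by auto
    with m_inv show ?case using coordinates_inverse by (auto simp: m_inv_real)
  next
    case (eng_add h1 h2)
    then obtain u v u' v' where "h1 = of_rat u + of_rat v * w" "h2 = of_rat u' + of_rat v' * w" by auto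
    then have "h1 \<oplus>\<^bsub>?R\<^esub> h2 = of_rat (u+u') + of_rat (v+v') * w" by (simp add: of_rat_add algebra_simps)
    then show ?case by blast
  next
    case (eng_mult h1 h2)
    then obtain u v u' v' where "h1 = of_rat u + of_rat v * w" "h2 = of_rat u' + of_rat v' * w" by auto
    then show ?case using coordinates_mult by auto
  qed
next
  let ?R = "ring_of_type_algebra :: real ring"
  fix x assume "x \<in> {of_rat u + of_rat v * w | u v. True}"
  then obtain u v where x: "x = of_rat u + of_rat v * w" by auto
  have "w \<in> K" unfolding quadratic_field_def by (rule generate_field.incl) simp
  then have "of_rat v * w \<in> K"
    using generate_field.eng_mult[of "of_rat v" ?R "{w}" w] of_rat_in_K[of v]
    by (simp add: quadratic_field_def)
  then show "x \<in> K"
    using generate_field.eng_add[of "of_rat u" ?R "{w}" "of_rat v * w"] of_rat_in_K[of u] x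
    by (simp add: quadratic_field_def)
qed

lemma in_K: "of_rat u + of_rat v * w \<in> K"
  unfolding quadratic_field_eq by auto

lemma K_cases:
  assumes "x \<in> K" obtains u v where "x = of_rat u + of_rat v * w"
  using assms unfolding quadratic_field_eq by auto

lemma of_int_in_K [simp]: "of_int k \<in> K"
  using of_rat_in_K[of "of_int k"] by simp

lemma w_in_K [simp]: "w \<in> K"
  using in_K[of 0 1] by simp

lemma zero_one_in_K [simp]: "0 \<in> K" "1 \<in> K"
  using of_int_in_K[of 0] of_int_in_K[of 1] by simp_all

lemma coordinates_add:
  "(of_rat u + of_rat v * w) + (of_rat u' + of_rat v' * w) = of_rat (u + u') + of_rat (v + v') * w"
  by (simp add: of_rat_add algebra_simps)

lemma K_add: "x \<in> K \<Longrightarrow> y \<in> K \<Longrightarrow> x + y \<in> K"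
  by (elim K_cases) (metis coordinates_add in_K)

lemma K_mult: "x \<in> K \<Longrightarrow> y \<in> K \<Longrightarrow> x * y \<in> K"
  by (elim K_cases) (metis coordinates_mult in_K)

lemma K_uminus: "x \<in> K \<Longrightarrow> - x \<in> K"
  using K_mult[of "-1" x] of_int_in_K[of "-1"] by simp

lemma K_power: "x \<in> K \<Longrightarrow> x ^ n \<in> K"
  by (induction n) (auto intro: K_mult)

lemma field_degree_eq: "field_degree K = 2"
proof -
  interpret V: vector_space "\<lambda>(q::rat) (x::real). of_rat q * x"
    by standard (auto simp: algebra_simps of_rat_add of_rat_mult)
  have w1: "w \<noteq> 1" using sqrt_irrational by (metis Rats_1)
  have span: "V.span {1, w} = K"
  proof -
    have "V.span {1, w} = {x. \<exists>a b. x - of_rat a * 1 - of_rat b * w = 0}"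
      by (simp add: V.span_insert V.span_empty)
    also have "\<dots> = K" unfolding quadratic_field_eq by (auto simp: algebra_simps)
    finally show ?thesis .
  qed
  have "V.independent {1, w}"
  proof -
    have "w \<notin> V.span {1}" 
      using sqrt_irrational by (auto simp: V.span_insert V.span_empty) 
    moreover have "V.independent {1}" by (simp add: V.independent_insert V.independent_empty)
    ultimately show ?thesis using V.independent_insert[of w "{1}"] by (simp add: insert_commute)
  qed
  then have "V.dim K = card {1, w}"
    by (metis V.dim_eq_card span V.span_span)
  then show ?thesis unfolding field_degree_def using w1 by simp
qed

text \<open>
  The nontrivial automorphism of \<open>K\<close>. Coordinates are unique, so the description determines the
  value on \<open>K\<close>; the value elsewhere is irrelevant.
\<close>

definition conjugate :: "real \<Rightarrow> real" where
  "conjugate x = (THE y. \<exists>u v. x = of_rat u + of_rat v * w \<and> y = of_rat u - of_rat v * w)"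

lemma conjugate_coordinates: "conjugate (of_rat u + of_rat v * w) = of_rat u - of_rat v * w"
  unfolding conjugate_def by (rule the_equality) (auto simp: coordinates_eq_iff)

lemma conjugate_in_K: "x \<in> K \<Longrightarrow> conjugate x \<in> K"
proof (elim K_cases)
  fix u v assume "x = of_rat u + of_rat v * w"
  then show ?thesis using in_K[of u "-v"] by (simp add: conjugate_coordinates of_rat_minus)
qed

lemma conjugate_add: 
  assumes "x \<in> K" "y \<in> K" shows "conjugate (x + y) = conjugate x + conjugate y"
proof -
  obtain u v u' v' where *: "x = of_rat u + of_rat v * w" "y = of_rat u' + of_rat v' * w"
    using assms by (elim K_cases)
  have "x + y = of_rat (u + u') + of_rat (v + v') * w"
    using * by (simp add: of_rat_add algebra_simps)
  then have "conjugate (x + y) = of_rat (u + u') - of_rat (v + v') * w"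
    by (simp only: conjugate_coordinates)
  then show ?thesis using * by (simp add: conjugate_coordinates of_rat_add algebra_simps)
qed

lemma conjugate_mult: 
  assumes "x \<in> K" "y \<in> K" shows "conjugate (x * y) = conjugate x * conjugate y"
proof -
  obtain u v u' v' where *: "x = of_rat u + of_rat v * w" "y = of_rat u' + of_rat v' * w"
    using assms by (elim K_cases)
  have "conjugate (x * y) = of_rat (u * u' + of_int D * v * v') - of_rat (u * v' + v * u') * w"
    by (simp only: * coordinates_mult conjugate_coordinates)
  also have "\<dots> = of_rat (u * u' + of_int D * (-v) * (-v')) + of_rat (u * (-v') + (-v) * u') * w"
    by (simp add: of_rat_minus of_rat_add of_rat_mult of_rat_diff algebra_simps)
  also have "\<dots> = conjugate x * conjugate y"
    unfolding coordinates_mult[symmetric] by (simp add: * conjugate_coordinates of_rat_minus)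
  finally show ?thesis .
qed

lemma conjugate_of_rat: "conjugate (of_rat q) = of_rat q"
  using conjugate_coordinates[of q 0] by simp

lemma conjugate_of_int [simp]: "conjugate (of_int k) = of_int k"
  using conjugate_of_rat[of "of_int k"] by simp

lemma conjugate_0_1 [simp]: "conjugate 0 = 0" "conjugate 1 = 1"
  using conjugate_of_int[of 0] conjugate_of_int[of 1] by simp_all

lemma conjugate_w: "conjugate w = - w"
  using conjugate_coordinates[of 0 1] by simp

lemma conjugate_power: "x \<in> K \<Longrightarrow> conjugate (x ^ n) = conjugate x ^ n"
  by (induction n) (auto simp: conjugate_mult K_power)

text \<open>
  A monic integer polynomial vanishing at \<open>x\<close> also vanishes at the conjugate of \<open>x\<close>.
\<close>

lemma conjugate_algebraic_int:
  assumes x: "x \<in> K" and "algebraic_int x" shows "algebraic_int (conjugate x)"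
proof -
  obtain p where p: "lead_coeff p = 1" "\<forall>i. coeff p i \<in> \<int>" "poly p x = 0"
    using assms(2) by (auto simp: algebraic_int.simps)
  have "poly q x \<in> K \<and> poly q (conjugate x) = conjugate (poly q x)" if "\<forall>i. coeff q i \<in> \<int>" for q
    using that
  proof (induction q)
    case 0
    then show ?case by simp
  next
    case (pCons a q)
    have "\<forall>i. coeff q i \<in> \<int>" 
      using pCons.prems by (metis coeff_pCons_Suc)
    then have IH: "poly q x \<in> K" "poly q (conjugate x) = conjugate (poly q x)" using pCons.IH by auto
    obtain k where k: "a = of_int k" using pCons.prems by (metis coeff_pCons_0 Ints_cases)
    show ?case using IH x 
      by (simp add: k K_add K_mult conjugate_add conjugate_mult)
  qed
  from this[of p] have "poly p (conjugate x) = 0" using p by simp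
  then show ?thesis using p by (auto simp: algebraic_int.simps)
qed

lemma real_embeddings_eq:
  "real_embeddings K = {restrict (\<lambda>x. x) K, restrict conjugate K}"
proof (intro equalityI subsetI)
  fix s assume s: "s \<in> real_embeddings K"
  have hom: "s (x * y) = s x * s y" "s (x + y) = s x + s y" "s 1 = 1" if "x \<in> K" "y \<in> K" for x y
    using s that unfolding real_embeddings_def ring_hom_def subring_of_reals_def by auto
  have ext: "s \<in> extensional K" using s unfolding real_embeddings_def by auto
  have s0: "s 0 = 0" using hom(2)[of 0 0] by simp
  have nat: "s (of_nat n) = of_nat n" for n
  proof (induction n)
    case (Suc n)
    have "(of_nat n :: real) \<in> K" using of_int_in_K[of "int n"] by simp
    then show ?case using hom(2)[of 1 "of_nat n"] hom(3) Suc by simp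
  qed (use s0 in simp)
  have neg: "s (- x) = - s x" if "x \<in> K" for x
    using hom(2)[of x "-x"] s0 that K_uminus by (simp add: eq_neg_iff_add_eq_0 add.commute)
  have int: "s (of_int k) = of_int k" for k
  proof (cases k)
    case (neg n)
    then show ?thesis using \<open>\<And>x. x \<in> K \<Longrightarrow> s (- x) = - s x\<close>[of "of_nat (Suc n)"] nat[of "Suc n"] 
      of_int_in_K[of "int (Suc n)"] by (simp del: of_nat_Suc)
  qed (use nat in simp)
  have rat: "s (of_rat q) = of_rat q" for q
  proof -
    obtain a b where ab: "q = of_int a / of_int b" "b \<noteq> 0"
      by (metis Fract_of_int_quotient Rat_cases less_irrefl)
    have "of_rat q * of_int b = (of_int a :: real)" using ab by (simp add: of_rat_divide)
    then have "s (of_rat q) * of_int b = of_int a"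
      using hom(1)[of "of_rat q" "of_int b"] of_rat_in_K by (simp add: int)
    then have "s (of_rat q) = of_int a / of_int b" using ab(2) by (simp add: eq_divide_eq)
    then show ?thesis by (simp add: ab(1) of_rat_divide)
  qed
  have "(s w)\<^sup>2 = of_int D" using hom(1)[of w w] D_pos int by (simp add: power2_eq_square)
  then have "(s w)\<^sup>2 = w\<^sup>2" using D_pos by simp
  then have "s w = w \<or> s w = - w" by (simp add: power2_eq_iff)
  moreover have "s (of_rat u + of_rat v * w) = of_rat u + of_rat v * s w" for u v
    using hom(1,2) of_rat_in_K K_mult rat by simp
  ultimately have "(\<forall>u v. s (of_rat u + of_rat v * w) = of_rat u + of_rat v * w) \<or>
     (\<forall>u v. s (of_rat u + of_rat v * w) = of_rat u - of_rat v * w)" by auto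
  then have "(\<forall>x\<in>K. s x = x) \<or> (\<forall>x\<in>K. s x = conjugate x)"
    by (metis K_cases conjugate_coordinates)
  then show "s \<in> {restrict (\<lambda>x. x) K, restrict conjugate K}"
    using ext by (auto intro!: extensionalityI[of _ K])
next
  fix s assume "s \<in> {restrict (\<lambda>x. x) K, restrict conjugate K}"
  then show "s \<in> real_embeddings K"
    unfolding real_embeddings_def ring_hom_def subring_of_reals_def
    by (auto simp: conjugate_mult conjugate_add K_add K_mult)
qed

lemma real_embeddings_distinct: "restrict (\<lambda>x. x) K \<noteq> restrict conjugate K"
proof
  assume "restrict (\<lambda>x. x) K = restrict conjugate K"
  then have "w = conjugate w" by (metis restrict_apply' w_in_K)
  then show False using w_pos by (simp add: conjugate_w)
qed

end

section \<open>Finite places\<close>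

context real_quadratic_field
begin

abbreviation OK :: "real set" where "OK \<equiv> carrier (ring_of_ints K)"

lemma ring_of_ints_simps [simp]:
  "OK = {x \<in> K. algebraic_int x}"
  "monoid.mult (ring_of_ints K) = (*)"
  "ring.add (ring_of_ints K) = (+)"
  "monoid.one (ring_of_ints K) = 1"
  "ring.zero (ring_of_ints K) = 0"
  by (simp_all add: ring_of_ints_def subring_of_reals_def)

lemma of_int_in_OK: "of_int k \<in> OK"
  by (auto intro: int_imp_algebraic_int)

lemma w_in_OK: "w \<in> OK"
  using algebraic_int_sqrt[OF int_imp_algebraic_int[of "of_int D :: real"]] by simp

lemma conjugate_in_OK: "x \<in> OK \<Longrightarrow> conjugate x \<in> OK"
  by (auto intro: conjugate_in_K conjugate_algebraic_int)

lemma rational_in_OK: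
  assumes "of_rat q \<in> OK" shows "\<exists>k. of_rat q = (of_int k :: real)"
proof -
  have "of_rat q \<in> (\<int> :: real set)"
    using assms by (intro rational_algebraic_int_is_int) auto
  then show ?thesis by (auto elim: Ints_cases)
qed

text \<open>
  For \<open>x = u + v w\<close> in the ring of integers, \<open>x + conjugate x = 2 u\<close> and
  \<open>(x - conjugate x) w = 2 v D\<close> are rational integers, and \<open>residue\<close> reduces both modulo \<open>N\<close>. The
  floors only serve to turn these reals into elements of type \<open>int\<close>.
\<close>

definition residue :: "int \<Rightarrow> real \<Rightarrow> int \<times> int" where
  "residue N x = (\<lfloor>x + conjugate x\<rfloor> mod N, \<lfloor>(x - conjugate x) * w\<rfloor> mod N)"

lemma residue_range: "N > 0 \<Longrightarrow> residue N x \<in> {0..<N} \<times> {0..<N}"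
  by (simp add: residue_def)

lemma quotient_carrier:
  "carrier (ring_of_ints K Quot I) = (\<lambda>a. (\<lambda>h. h + a) ` I) ` OK"
  by (auto simp: FactRing_def A_RCOSETS_def' a_r_coset_def' image_def)

end

text \<open>
  One nonzero prime ideal \<open>\<pp>\<close> of the ring of integers. That the algebraic integers of \<open>K\<close> are closed under
  addition and multiplication is not proved separately: it is part of the statement that \<open>\<pp>\<close> is
  an ideal of a ring, and the closure facts are only needed where a place is given.
\<close>

locale finite_place = real_quadratic_field +
  fixes \<pp> :: "real set"
  assumes place: "\<pp> \<in> finite_places K"
begin

lemma prime_ideal: "primeideal \<pp> (ring_of_ints K)"
  using place by (simp add: finite_places_def)

lemma OK_add: "x \<in> OK \<Longrightarrow> y \<in> OK \<Longrightarrow> x + y \<in> OK"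
  and OK_mult: "x \<in> OK \<Longrightarrow> y \<in> OK \<Longrightarrow> x * y \<in> OK"
proof -
  interpret primeideal \<pp> "ring_of_ints K" by (rule prime_ideal)
  show "x \<in> OK \<Longrightarrow> y \<in> OK \<Longrightarrow> x + y \<in> OK" using add.m_closed[of x y] by simp
  show "x \<in> OK \<Longrightarrow> y \<in> OK \<Longrightarrow> x * y \<in> OK" using m_closed[of x y] by simp
qed

lemma OK_diff: "x \<in> OK \<Longrightarrow> y \<in> OK \<Longrightarrow> x - y \<in> OK"
  using OK_add[of x "of_int (-1) * y"] OK_mult[OF of_int_in_OK, of y "-1"] by simp

lemma OK_power: "x \<in> OK \<Longrightarrow> x ^ n \<in> OK"
  by (induction n) (use of_int_in_OK[of 1] OK_mult in \<open>auto simp del: ring_of_ints_simps(1)\<close>)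

lemma OK_prod: "(\<And>i. i \<in> I \<Longrightarrow> f i \<in> OK) \<Longrightarrow> (\<Prod>i\<in>I. f i) \<in> OK"
  by (induction I rule: infinite_finite_induct)
     (use of_int_in_OK[of 1] OK_mult in \<open>auto simp del: ring_of_ints_simps(1)\<close>)

lemma OK_sum: "(\<And>i. i \<in> I \<Longrightarrow> f i \<in> OK) \<Longrightarrow> (\<Sum>i\<in>I. f i) \<in> OK"
  by (induction I rule: infinite_finite_induct)
     (use of_int_in_OK[of 0] OK_add in \<open>auto simp del: ring_of_ints_simps(1)\<close>)

lemma ideal_closed:
  assumes "ideal I (ring_of_ints K)"
  shows "0 \<in> I" "x \<in> I \<Longrightarrow> x \<in> OK" "x \<in> I \<Longrightarrow> y \<in> I \<Longrightarrow> x + y \<in> I"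
    "x \<in> I \<Longrightarrow> y \<in> OK \<Longrightarrow> x * y \<in> I" "x \<in> I \<Longrightarrow> y \<in> OK \<Longrightarrow> y * x \<in> I"
    "x \<in> I \<Longrightarrow> y \<in> I \<Longrightarrow> x - y \<in> I"
proof -
  interpret ideal I "ring_of_ints K" by (rule assms)
  show "0 \<in> I" using additive_subgroup.zero_closed[OF is_additive_subgroup] by simp
  show "x \<in> OK" if "x \<in> I" using Icarr[OF that] .
  show add: "x + y \<in> I" if "x \<in> I" "y \<in> I" for x y using additive_subgroup.a_closed[OF is_additive_subgroup that] by simp
  show "x * y \<in> I" if "x \<in> I" "y \<in> OK" using I_r_closed[OF that] by simp
  show m: "y * x \<in> I" if "x \<in> I" "y \<in> OK" for x y using I_l_closed[OF that] by simp
  show "x - y \<in> I" if "x \<in> I" "y \<in> I"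
    using add[OF that(1) m[OF that(2) of_int_in_OK[of "-1"]]] by simp
qed

lemmas place_closed = ideal_closed[OF primeideal.axioms(1)[OF prime_ideal]]

lemma place_prime: "x \<in> OK \<Longrightarrow> y \<in> OK \<Longrightarrow> x * y \<in> \<pp> \<Longrightarrow> x \<in> \<pp> \<or> y \<in> \<pp>"
  using primeideal.I_prime[OF prime_ideal, of x y] by simp

lemma one_notin_place: "1 \<notin> \<pp>"
proof
  assume "1 \<in> \<pp>"
  then have "OK \<subseteq> \<pp>" using place_closed(4)[of 1] by (auto simp del: ring_of_ints_simps(1))
  then show False using primeideal.I_notcarr[OF prime_ideal] place_closed(2) by blast
qed

lemma place_power:
  assumes "x \<in> OK" "x ^ n \<in> \<pp>" shows "x \<in> \<pp>"
  using assms(2)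
proof (induction n)
  case 0
  then show ?case using one_notin_place by simp
next
  case (Suc n)
  then show ?case using place_prime[of x "x ^ n"] assms(1) OK_power by auto
qed

lemma trace_int:
  assumes "x \<in> OK" obtains i where "x + conjugate x = of_int i"
proof -
  obtain u v where x: "x = of_rat u + of_rat v * w" using assms by (auto elim: K_cases)
  then have "x + conjugate x = of_rat (2 * u)" by (simp add: conjugate_coordinates of_rat_mult)
  moreover have "x + conjugate x \<in> OK" using assms by (intro OK_add conjugate_in_OK)
  ultimately show ?thesis using rational_in_OK that by metis
qed

lemma cotrace_int:
  assumes "x \<in> OK" obtains j where "(x - conjugate x) * w = of_int j"
proof -
  obtain u v where x: "x = of_rat u + of_rat v * w" using assms by (auto elim: K_cases)
  have "(x - conjugate x) * w = 2 * of_rat v * (w * w)" 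
    by (simp add: x conjugate_coordinates)
  also have "\<dots> = of_rat (2 * v * of_int D)" unfolding w_sq by (simp add: of_rat_mult)
  finally have "(x - conjugate x) * w = of_rat (2 * v * of_int D)" .
  moreover have "(x - conjugate x) * w \<in> OK" 
    using assms by (intro OK_mult OK_diff conjugate_in_OK w_in_OK)
  ultimately show ?thesis using rational_in_OK that by metis
qed

lemma norm_int:
  assumes "x \<in> OK" obtains k where "x * conjugate x = of_int k"
proof -
  obtain u v where x: "x = of_rat u + of_rat v * w" using assms by (auto elim: K_cases)
  have "x * conjugate x = of_rat u * of_rat u - of_rat v * of_rat v * (w * w)"
    by (simp add: x conjugate_coordinates algebra_simps)
  also have "\<dots> = of_rat (u * u - v * v * of_int D)" unfolding w_sq by (simp add: of_rat_mult of_rat_diff)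
  finally have "x * conjugate x = of_rat (u * u - v * v * of_int D)" .
  moreover have "x * conjugate x \<in> OK" using assms by (intro OK_mult conjugate_in_OK)
  ultimately show ?thesis using rational_in_OK that by metis
qed

text \<open>
  The factor \<open>2 D\<close> compensates for the denominators of the coordinates: integers of \<open>K\<close>
  need not lie in \<open>\<int> + \<int> w\<close>, but equality of residues modulo \<open>2 D m\<close> makes the difference
  divisible by \<open>m\<close> in the ring of integers.
\<close>

lemma residue_eqD:
  assumes "x \<in> OK" "y \<in> OK" "residue (2 * D * m) x = residue (2 * D * m) y"
  shows "\<exists>t\<in>OK. x - y = of_int m * t"
proof -
  obtain i where i: "x + conjugate x = of_int i" using trace_int assms by blast
  obtain i' where i': "y + conjugate y = of_int i'" using trace_int assms by blast
  obtain j where j: "(x - conjugate x) * w = of_int j" using cotrace_int assms by blast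
  obtain j' where j': "(y - conjugate y) * w = of_int j'" using cotrace_int assms by blast
  from assms(3) have "i mod (2 * D * m) = i' mod (2 * D * m)" "j mod (2 * D * m) = j' mod (2 * D * m)"
    unfolding residue_def i i' j j' by auto
  then obtain s t where st: "i - i' = 2 * D * m * s" "j - j' = 2 * D * m * t"
    by (metis mod_eq_dvd_iff dvd_def)
  \<comment> \<open>The identity is stated for abstract \<open>W\<close> and \<open>d\<close> because \<open>w\<close> itself contains \<open>D\<close>.\<close>
  have *: "2 * of_int m * (d * of_int s * W + d * of_int t) = 2 * (of_int m * (d * of_int s + of_int t * W)) * W"
    if "W * W = d" for W d :: real
    unfolding that[symmetric] by (simp add: algebra_simps)
  have "2 * (x - y) * w = (x + conjugate x - (y + conjugate y)) * w + ((x - conjugate x) * w - (y - conjugate y) * w)"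
    by (simp add: algebra_simps)
  also have "\<dots> = of_int (i - i') * w + of_int (j - j')" by (simp only: i i' j j' of_int_diff)
  also have "\<dots> = 2 * of_int m * (of_int D * of_int s * w + of_int D * of_int t)"
    by (simp add: st algebra_simps)
  also have "\<dots> = 2 * (of_int m * (of_int D * of_int s + of_int t * w)) * w"
    using *[OF w_sq] .
  finally have "2 * (x - y) = 2 * (of_int m * (of_int D * of_int s + of_int t * w))"
    using w_pos by (metis mult_right_cancel less_irrefl)
  then have "x - y = of_int m * (of_int D * of_int s + of_int t * w)"
    by (metis mult_left_cancel zero_neq_numeral)
  moreover have "of_int D * of_int s + of_int t * w \<in> OK"
    by (intro OK_add OK_mult of_int_in_OK w_in_OK)
  ultimately show ?thesis by blast
qed

lemma residue_eq_place:
  assumes "x \<in> OK" "y \<in> OK" "residue (2 * D * m) x = residue (2 * D * m) y" "of_int m \<in> \<pp>"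
  shows "x - y \<in> \<pp>"
  using residue_eqD[OF assms(1-3)] place_closed(4)[OF assms(4)] by metis

text \<open>
  The norm of a nonzero element of \<open>\<pp>\<close> is such an integer, up to sign.
\<close>

lemma nonzero_int_in_place: obtains m where "m > 0" "of_int m \<in> \<pp>"
proof -
  have "\<pp> \<noteq> {0}" using place by (simp add: finite_places_def)
  then obtain x where x: "x \<in> \<pp>" "x \<noteq> 0" using place_closed(1) by auto
  have xO: "x \<in> OK" using x place_closed(2) by blast
  obtain k where k: "x * conjugate x = of_int k" using norm_int[OF xO] .
  have "conjugate x \<noteq> 0"
  proof -
    obtain u v where xuv: "x = of_rat u + of_rat v * w" using xO by (auto elim: K_cases)
    then show ?thesis using x(2) coordinates_eq_0_iff[of u v] coordinates_eq_0_iff[of u "-v"]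
      by (auto simp: conjugate_coordinates of_rat_minus)
  qed
  then have "k \<noteq> 0" using k x by auto
  have kp: "of_int k \<in> \<pp>" using place_closed(4)[OF x(1) conjugate_in_OK[OF xO]] k by simp
  then have "of_int (-k) \<in> \<pp>" using place_closed(4)[OF kp of_int_in_OK[of "-1"]] by simp
  then show ?thesis using kp \<open>k \<noteq> 0\<close> that[of k] that[of "-k"] by (cases "k > 0") auto
qed

text \<open>
  Nonzero primes are maximal. Modulo a nonzero integer in \<open>\<pp>\<close> there are finitely many residues, so
  two powers of \<open>c\<close> agree modulo \<open>\<pp>\<close>, and cancelling the smaller one exhibits a power of \<open>c\<close> as an
  inverse.
\<close>

lemma inverse_mod_place:
  assumes c: "c \<in> OK" "c \<notin> \<pp>"
  shows "\<exists>g\<in>OK. 1 - c * g \<in> \<pp>"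
proof -
  obtain m where m: "m > 0" "of_int m \<in> \<pp>" by (rule nonzero_int_in_place)
  let ?f = "\<lambda>k::nat. residue (2 * D * m) (c ^ k)"
  have "finite (range ?f)"
    using m D_pos
    by (intro finite_subset[of "range ?f" "{0..<2 * D * m} \<times> {0..<2 * D * m}"] image_subsetI residue_range)
       (simp_all del: mem_Times_iff)
  then have "\<not> inj ?f" using finite_imageD infinite_UNIV_nat by blast
  then obtain i j where ij: "i < j" "?f j = ?f i"
    unfolding inj_def by (metis linorder_neqE_nat)
  then have "c ^ i - c ^ j \<in> \<pp>" using residue_eq_place OK_power c m by metis
  moreover have "c ^ i - c ^ j = c ^ i * (1 - c * c ^ (j - i - 1))"
    using ij by (simp add: algebra_simps flip: power_add power_Suc)
  ultimately have "c ^ i * (1 - c * c ^ (j - i - 1)) \<in> \<pp>" by simp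
  moreover have "1 - c * c ^ (j - i - 1) \<in> OK" 
    using c(1) of_int_in_OK[of 1] by (intro OK_diff OK_mult OK_power) auto
  ultimately have "1 - c * c ^ (j - i - 1) \<in> \<pp>" 
    using place_prime[of "c ^ i"] place_power[of c i] c OK_power by blast
  then show ?thesis using c OK_power by blast
qed

lemma place_power_ideal: "ideal (\<pp> [^]\<^bsub>ideals_set (ring_of_ints K)\<^esub> (k::nat)) (ring_of_ints K)"
proof (induction k)
  case 0
  interpret primeideal \<pp> "ring_of_ints K" by (rule prime_ideal)
  show ?case using oneideal by (simp add: ideals_set_def)
next
  case (Suc k)
  interpret primeideal \<pp> "ring_of_ints K" by (rule prime_ideal)
  show ?case using ideal_prod_is_ideal[OF Suc is_ideal] by (simp add: ideals_set_def nat_pow_def)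
qed

lemma inverse_mod_place_power:
  assumes c: "c \<in> OK" "c \<notin> \<pp>"
  shows "\<exists>g\<in>OK. 1 - c * g \<in> \<pp> [^]\<^bsub>ideals_set (ring_of_ints K)\<^esub> (k::nat)"
proof (induction k)
  case 0
  have "1 - c * 0 \<in> OK" using of_int_in_OK[of 1] by simp
  moreover have "0 \<in> OK" using of_int_in_OK[of 0] by simp
  moreover have "\<pp> [^]\<^bsub>ideals_set (ring_of_ints K)\<^esub> (0::nat) = OK" by (simp add: ideals_set_def)
  ultimately show ?case by blast
next
  case (Suc k)
  let ?I = "\<pp> [^]\<^bsub>ideals_set (ring_of_ints K)\<^esub> k"
  obtain g where g: "g \<in> OK" "1 - c * g \<in> ?I" using Suc by blast
  obtain h where h: "h \<in> OK" "1 - c * h \<in> \<pp>" using inverse_mod_place[OF c] by blast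
  have "(1 - c * g) * (1 - c * h) \<in> ideal_prod (ring_of_ints K) ?I \<pp>"
    using ideal_prod.prod[OF g(2) h(2), of "ring_of_ints K"] by simp
  moreover have "(1 - c * g) * (1 - c * h) = 1 - c * (g + h - c * g * h)" by (simp add: algebra_simps)
  moreover have "g + h - c * g * h \<in> OK" using c g h by (intro OK_diff OK_add OK_mult)
  ultimately show ?case by (auto simp: ideals_set_def nat_pow_def simp del: ring_of_ints_simps)
qed

text \<open>
  An element outside \<open>\<pp>\<close> is invertible modulo every power of \<open>\<pp>\<close>, so multiplying by it does not
  change membership in these powers.
\<close>

lemma integral_valuation_mult_cancel:
  assumes c: "c \<in> OK" "c \<notin> \<pp>" and b: "b \<in> OK"
  shows "integral_valuation K \<pp> (c * b) = integral_valuation K \<pp> b"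
proof -
  have "c * b \<in> \<pp> [^]\<^bsub>ideals_set (ring_of_ints K)\<^esub> k \<longleftrightarrow> b \<in> \<pp> [^]\<^bsub>ideals_set (ring_of_ints K)\<^esub> k" for k :: nat
  proof
    let ?I = "\<pp> [^]\<^bsub>ideals_set (ring_of_ints K)\<^esub> k"
    note cl = ideal_closed[OF place_power_ideal[of k]]
    assume cb: "c * b \<in> ?I"
    obtain g where g: "g \<in> OK" "1 - c * g \<in> ?I" using inverse_mod_place_power[OF c] by blast
    have "(1 - c * g) * b + c * b * g \<in> ?I" using cl cb g b by blast
    then show "b \<in> ?I" by (simp add: algebra_simps)
  next
    assume "b \<in> \<pp> [^]\<^bsub>ideals_set (ring_of_ints K)\<^esub> k"
    then show "c * b \<in> \<pp> [^]\<^bsub>ideals_set (ring_of_ints K)\<^esub> k"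
      using ideal_closed(5)[OF place_power_ideal[of k]] c by blast
  qed
  then show ?thesis unfolding integral_valuation_def by simp
qed

text \<open>
  Any two integers \<open>a\<close>, \<open>b\<close> with \<open>c = a / b\<close> satisfy \<open>a = c * b\<close>, so the preceding lemma shows
  that every admissible difference of valuations vanishes, whichever quotient is chosen.
\<close>

lemma valuation_eq_0:
  assumes c: "c \<in> OK" "c \<notin> \<pp>"
  shows "valuation K \<pp> c = 0"
  unfolding valuation_def
proof (rule some_equality)
  have "c \<noteq> 0" using c place_closed(1) by auto
  then show "\<exists>a\<in>OK. \<exists>b\<in>OK. a \<noteq> 0 \<and> b \<noteq> 0 \<and> c = a / b \<and>
      0 = int (integral_valuation K \<pp> a) - int (integral_valuation K \<pp> b)"
    using integral_valuation_mult_cancel[OF c of_int_in_OK[of 1]] c(1) of_int_in_OK[of 1]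
    by (intro bexI[of _ c] bexI[of _ 1]) auto
next
  fix m assume "\<exists>a\<in>OK. \<exists>b\<in>OK. a \<noteq> 0 \<and> b \<noteq> 0 \<and> c = a / b \<and>
      m = int (integral_valuation K \<pp> a) - int (integral_valuation K \<pp> b)"
  then obtain a b where "b \<in> OK" "b \<noteq> 0" "c = a / b" 
    "m = int (integral_valuation K \<pp> a) - int (integral_valuation K \<pp> b)" by blast
  then show "m = 0" using integral_valuation_mult_cancel[OF c, of b] by simp
qed

lemma unit_notin_place:
  assumes "x \<in> OK" "y \<in> OK" "x * y = 1" shows "x \<notin> \<pp>"
  using place_closed(4)[of x y] assms one_notin_place by metis

lemma finite_abs_unit:
  assumes "x \<in> OK" "y \<in> OK" "x * y = 1" shows "finite_abs K \<pp> x = 1"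
  using valuation_eq_0[OF assms(1) unit_notin_place[OF assms]] assms(3) by (auto simp: finite_abs_def)

lemma coset_eq_iff:
  assumes "x \<in> OK" "y \<in> OK"
  shows "(\<lambda>h. h + x) ` \<pp> = (\<lambda>h. h + y) ` \<pp> \<longleftrightarrow> x - y \<in> \<pp>"
proof
  assume "(\<lambda>h. h + x) ` \<pp> = (\<lambda>h. h + y) ` \<pp>"
  then have "0 + x \<in> (\<lambda>h. h + y) ` \<pp>" using place_closed(1) by blast
  then show "x - y \<in> \<pp>" by auto
next
  assume *: "x - y \<in> \<pp>"
  show "(\<lambda>h. h + x) ` \<pp> = (\<lambda>h. h + y) ` \<pp>"
  proof (intro equalityI subsetI)
    fix z assume "z \<in> (\<lambda>h. h + x) ` \<pp>"
    then obtain h where "h \<in> \<pp>" "z = h + x" by blast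
    then have "h + (x - y) \<in> \<pp>" "z = (h + (x - y)) + y" using * place_closed(3) by auto
    then show "z \<in> (\<lambda>h. h + y) ` \<pp>" by blast
  next
    fix z assume "z \<in> (\<lambda>h. h + y) ` \<pp>"
    then obtain h where "h \<in> \<pp>" "z = h + y" by blast
    then have "h - (x - y) \<in> \<pp>" "z = (h - (x - y)) + x" using * place_closed(6) by auto
    then show "z \<in> (\<lambda>h. h + x) ` \<pp>" by blast
  qed
qed

lemma ideal_norm_pos: "ideal_norm K \<pp> > 0"
proof -
  obtain m where m: "m > 0" "of_int m \<in> \<pp>" by (rule nonzero_int_in_place)
  let ?R = "{0..<2 * D * m} \<times> {0..<2 * D * m}"
  let ?c = "\<lambda>a. (\<lambda>h. h + a) ` \<pp>"
  have "?c ` OK \<subseteq> (\<lambda>r. ?c (inv_into OK (residue (2 * D * m)) r)) ` ?R"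
  proof
    fix z assume "z \<in> ?c ` OK"
    then obtain a where a: "a \<in> OK" "z = ?c a" by blast
    \<comment> \<open>The coset of \<open>a\<close> depends only on its residue, of which there are finitely many.\<close>
    let ?r = "residue (2 * D * m) a" and ?b = "inv_into OK (residue (2 * D * m)) (residue (2 * D * m) a)"
    have b: "?b \<in> OK" "residue (2 * D * m) ?b = ?r"
      using a by (auto intro: inv_into_into f_inv_into_f simp del: ring_of_ints_simps)
    then have "z = ?c ?b" using a coset_eq_iff[of a ?b] residue_eq_place[of a ?b m] m by metis
    moreover have "?r \<in> ?R" using residue_range[of "2 * D * m" a] m D_pos by simp
    ultimately show "z \<in> (\<lambda>r. ?c (inv_into OK (residue (2 * D * m)) r)) ` ?R"
      by (intro image_eqI[where x = ?r])
  qed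
  then have "finite (?c ` OK)" by (rule finite_subset) simp
  moreover have "?c ` OK \<noteq> {}" using of_int_in_OK by blast
  ultimately show ?thesis unfolding ideal_norm_def quotient_carrier by (simp add: card_gt_0_iff)
qed

end

section \<open>Norms of primes containing a given integer\<close>

context real_quadratic_field
begin

lemma finite_placeI: "\<pp> \<in> finite_places K \<Longrightarrow> finite_place D \<pp>"
  by unfold_locales

lemma finite_places_incomparable:
  assumes "p \<in> finite_places K" "q \<in> finite_places K" "p \<noteq> q"
  shows "\<exists>x\<in>q. x \<notin> p"
proof (rule ccontr)
  interpret p: finite_place D p using assms by (intro finite_placeI)
  interpret q: finite_place D q using assms by (intro finite_placeI)
  assume "\<not> (\<exists>x\<in>q. x \<notin> p)"
  then have sub: "q \<subseteq> p" by blast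
  then obtain y where y: "y \<in> p" "y \<notin> q" using assms(3) by blast
  then obtain g where g: "g \<in> OK" "1 - y * g \<in> q" 
    using q.inverse_mod_place p.place_closed(2) by blast
  then have "(1 - y * g) + y * g \<in> p" using sub y p.place_closed(3,4) by blast
  then show False using p.one_notin_place by simp
qed

text \<open>
  For each \<open>q \<noteq> p\<close> in \<open>S\<close> choose an element of \<open>q\<close> outside \<open>p\<close>; their product lies in all
  these \<open>q\<close> and, after multiplication by an inverse modulo \<open>p\<close>, is congruent to 1 modulo \<open>p\<close>.
\<close>

lemma chinese_remainder_idempotent:
  assumes S: "finite S" "S \<subseteq> finite_places K" and p: "p \<in> S"
  shows "\<exists>e\<in>OK. e - 1 \<in> p \<and> (\<forall>q\<in>S - {p}. e \<in> q)"
proof -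
  interpret p: finite_place D p using assms by (intro finite_placeI) auto
  have "\<forall>q\<in>S - {p}. \<exists>x. x \<in> q \<and> x \<notin> p" using finite_places_incomparable S p by blast
  then obtain f where f: "\<And>q. q \<in> S - {p} \<Longrightarrow> f q \<in> q \<and> f q \<notin> p" by metis
  have fO: "f q \<in> OK" if "q \<in> S - {p}" for q
  proof -
    interpret q: finite_place D q using that S by (intro finite_placeI) auto
    show ?thesis using f[OF that] q.place_closed(2) by blast
  qed
  define c where "c = (\<Prod>q\<in>S - {p}. f q)"
  have cO: "c \<in> OK" unfolding c_def using fO by (rule p.OK_prod)
  have "(\<Prod>q\<in>T. f q) \<notin> p" if "finite T" "T \<subseteq> S - {p}" for T
    using that
  proof induction
    case empty
    then show ?case using p.one_notin_place by simp
  next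
    case (insert q T)
    have "(\<Prod>q\<in>T. f q) \<in> OK" using insert.prems fO by (intro p.OK_prod) auto
    then show ?case using insert p.place_prime[of "f q" "\<Prod>q\<in>T. f q"] f[of q] fO[of q] by auto
  qed
  then have "c \<notin> p" unfolding c_def using S by simp
  then obtain g where g: "g \<in> OK" "1 - c * g \<in> p" using p.inverse_mod_place cO by blast
  have "c * g - 1 \<in> p" using p.place_closed(6)[OF p.place_closed(1) g(2)] by simp
  moreover have "c * g \<in> q" if q: "q \<in> S - {p}" for q
  proof -
    interpret q: finite_place D q using q S by (intro finite_placeI) auto
    have "c = f q * (\<Prod>q\<in>S - {p} - {q}. f q)" unfolding c_def using S q by (intro prod.remove) auto
    moreover have "(\<Prod>q\<in>S - {p} - {q}. f q) \<in> OK" using fO by (intro p.OK_prod) auto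
    ultimately show ?thesis using f[OF q] g(1) q.place_closed(4) by metis
  qed
  ultimately show ?thesis using p.OK_mult[OF cO g(1)] by blast
qed

lemma chinese_remainder_places:
  assumes S: "finite S" "S \<subseteq> finite_places K" and r: "\<And>p. p \<in> S \<Longrightarrow> r p \<in> OK"
  shows "\<exists>x\<in>OK. \<forall>p\<in>S. x - r p \<in> p"
proof (cases "S = {}")
  case True
  then show ?thesis using of_int_in_OK by blast
next
  case False
  then obtain p0 where "p0 \<in> S" by blast
  then interpret p0: finite_place D p0 using S by (intro finite_placeI) auto
  obtain e where e: "\<And>p. p \<in> S \<Longrightarrow> e p \<in> OK \<and> e p - 1 \<in> p \<and> (\<forall>q\<in>S - {p}. e p \<in> q)"
    using chinese_remainder_idempotent[OF S] by metis
  define x where "x = (\<Sum>p\<in>S. e p * r p)"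
  have "x \<in> OK" unfolding x_def using e r by (intro p0.OK_sum p0.OK_mult) auto
  moreover have "x - r q \<in> q" if q: "q \<in> S" for q
  proof -
    interpret q: finite_place D q using q S by (intro finite_placeI) auto
    have "x - r q = (e q - 1) * r q + (\<Sum>p\<in>S - {q}. e p * r p)"
      unfolding x_def by (subst sum.remove[OF S(1) q]) (simp add: algebra_simps)
    moreover have "(\<Sum>p\<in>T. e p * r p) \<in> q" if "finite T" "T \<subseteq> S - {q}" for T
      using that
    proof induction
      case empty
      then show ?case using q.place_closed(1) by simp
    next
      case (insert p T)
      then have "e p * r p \<in> q" using e[of p] r[of p] q q.place_closed(4) by blast
      then show ?case using insert q.place_closed(3) by simp
    qed
    moreover have "(e q - 1) * r q \<in> q" using e[OF q] r[OF q] q.place_closed(4) by blast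
    ultimately show ?thesis using q.place_closed(3) S(1) by simp
  qed
  ultimately show ?thesis by blast
qed

text \<open>
  By the Chinese remainder theorem every family of cosets, one for each prime in \<open>S\<close>, is the family
  of cosets of a single integer of \<open>K\<close>. Since \<open>m\<close> lies in all these primes, that family depends
  only on a residue modulo \<open>2 D m\<close>, so there are at most \<open>(2 D m)\<^sup>2\<close> families.
\<close>

lemma prod_ideal_norm_le:
  assumes S: "finite S" "S \<subseteq> finite_places K" and m: "m > 0" "\<And>p. p \<in> S \<Longrightarrow> of_int m \<in> p"
  shows "int (\<Prod>p\<in>S. ideal_norm K p) \<le> (2 * D * m)\<^sup>2"
proof -
  define N where "N = 2 * D * m"
  have N: "N > 0" unfolding N_def using m D_pos by simp
  let ?c = "\<lambda>p a. (\<lambda>h. h + a) ` p"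
  let ?Q = "\<lambda>p. ?c p ` OK"
  let ?\<phi> = "\<lambda>x. restrict (\<lambda>p. ?c p x) S"
  let ?R = "{0..<N} \<times> {0..<N}"
  have "PiE S ?Q \<subseteq> (\<lambda>t. ?\<phi> (inv_into OK (residue N) t)) ` ?R"
  proof
    fix F assume F: "F \<in> PiE S ?Q"
    then have "\<forall>p\<in>S. \<exists>a. a \<in> OK \<and> F p = ?c p a" by (auto simp: PiE_iff simp del: ring_of_ints_simps)
    then obtain r where r: "\<And>p. p \<in> S \<Longrightarrow> r p \<in> OK \<and> F p = ?c p (r p)" by metis
    then obtain x where x: "x \<in> OK" "\<And>p. p \<in> S \<Longrightarrow> x - r p \<in> p"
      using chinese_remainder_places[OF S, of r] by blast
    let ?y = "inv_into OK (residue N) (residue N x)"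
    have y: "?y \<in> OK" "residue N ?y = residue N x"
      using x by (auto intro: inv_into_into f_inv_into_f simp del: ring_of_ints_simps)
    have "F p = ?c p ?y" if p: "p \<in> S" for p
    proof -
      interpret p: finite_place D p using p S by (intro finite_placeI) auto
      have "?c p x = ?c p (r p)" using p.coset_eq_iff[of x "r p"] x r p by blast
      moreover have "?c p ?y = ?c p x"
        using p.coset_eq_iff[of ?y x] p.residue_eq_place[of ?y x m] y x m(2)[OF p] N_def by blast
      ultimately show ?thesis using r[OF p] by simp
    qed
    then have "F = ?\<phi> ?y" using F by (intro extensionalityI[of _ S]) (auto simp: PiE_iff)
    moreover have "residue N x \<in> ?R" using residue_range[OF N] .
    ultimately show "F \<in> (\<lambda>t. ?\<phi> (inv_into OK (residue N) t)) ` ?R"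
      by (intro image_eqI[where x = "residue N x"])
  qed
  then have "card (PiE S ?Q) \<le> card ?R" by (intro surj_card_le) auto
  moreover have "card (PiE S ?Q) = (\<Prod>p\<in>S. ideal_norm K p)"
    unfolding card_PiE[OF S(1)] ideal_norm_def quotient_carrier ..
  moreover have "int (card ?R) = N\<^sup>2" using N by (simp add: card_cartesian_product power2_eq_square)
  ultimately show ?thesis unfolding N_def by linarith
qed

end

section \<open>Height and radical\<close>

context real_quadratic_field
begin

text \<open>
  Both real embeddings contribute at least the logarithm of \<open>max \<bar>a\<bar> \<bar>b\<bar>\<close>, because conjugation
  interchanges \<open>\<bar>a\<bar>\<close> and \<open>\<bar>b\<bar>\<close>, and this cancels the factor \<open>1/2\<close>. Since \<open>a\<close> is a unit, each
  finite place contributes the logarithm of a number that is at least 1.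
\<close>

lemma abc_height_ge:
  assumes K: "a \<in> K" "b \<in> K" "c \<in> K" and nz: "a \<noteq> 0"
    and conj: "\<bar>conjugate a\<bar> = \<bar>b\<bar>" "\<bar>conjugate b\<bar> = \<bar>a\<bar>"
    and unit: "\<And>\<pp>. \<pp> \<in> finite_places K \<Longrightarrow> finite_abs K \<pp> a = 1"
  shows "ln (max \<bar>a\<bar> \<bar>b\<bar>) \<le> abc_height K a b c"
proof -
  define h where "h \<sigma> = ln (Max {\<bar>\<sigma> a\<bar>, \<bar>\<sigma> b\<bar>, \<bar>\<sigma> c\<bar>})" for \<sigma> :: "real \<Rightarrow> real"
  have le: "ln (max \<bar>a\<bar> \<bar>b\<bar>) \<le> ln (Max {s, t, u})"
    if "s = \<bar>a\<bar> \<and> t = \<bar>b\<bar> \<or> s = \<bar>b\<bar> \<and> t = \<bar>a\<bar>" for s t u :: real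
    using that nz by (intro ln_mono) auto
  have "2 * ln (max \<bar>a\<bar> \<bar>b\<bar>) \<le> h (restrict (\<lambda>x. x) K) + h (restrict conjugate K)"
  proof -
    have "h (restrict (\<lambda>x. x) K) = ln (Max {\<bar>a\<bar>, \<bar>b\<bar>, \<bar>c\<bar>})"
      and "h (restrict conjugate K) = ln (Max {\<bar>b\<bar>, \<bar>a\<bar>, \<bar>conjugate c\<bar>})"
      unfolding h_def restrict_apply' [OF K(1)] restrict_apply'[OF K(2)] restrict_apply'[OF K(3)] conj
      by (rule refl)+
    then show ?thesis using le[of "\<bar>a\<bar>" "\<bar>b\<bar>" "\<bar>c\<bar>"] le[of "\<bar>b\<bar>" "\<bar>a\<bar>" "\<bar>conjugate c\<bar>"]
      by linarith
  qed
  also have "\<dots> = (\<Sum>\<sigma>\<in>real_embeddings K. h \<sigma>)"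
    unfolding real_embeddings_eq using real_embeddings_distinct by simp
  finally have arch: "2 * ln (max \<bar>a\<bar> \<bar>b\<bar>) \<le> (\<Sum>\<sigma>\<in>real_embeddings K. h \<sigma>)" .
  \<comment> \<open>Summability is not needed: a sum that does not converge has the value 0 by convention.\<close>
  have "0 \<le> (\<Sum>\<^sub>\<infinity>\<pp>\<in>finite_places K.
           ln (Max {finite_abs K \<pp> a, finite_abs K \<pp> b, finite_abs K \<pp> c}))"
    using unit by (intro infsum_nonneg) (auto intro!: ln_ge_zero)
  then show ?thesis
    using arch unfolding abc_height_def field_degree_eq h_def by simp
qed

text \<open>
  If \<open>a\<close> and \<open>b\<close> have valuation 0 everywhere, the support consists of places where \<open>c\<close> has nonzero
  valuation; these contain \<open>c\<close> and hence \<open>m\<close>.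
\<close>

lemma abc_radical_le:
  assumes unit: "\<And>\<pp>. \<pp> \<in> finite_places K \<Longrightarrow> valuation K \<pp> a = 0"
      "\<And>\<pp>. \<pp> \<in> finite_places K \<Longrightarrow> valuation K \<pp> b = 0"
    and c: "c \<in> OK"
    and m: "m > 0" "\<And>\<pp>. \<pp> \<in> finite_places K \<Longrightarrow> c \<in> \<pp> \<Longrightarrow> of_int m \<in> \<pp>"
  shows "abc_radical K a b c \<le> ln (2 * of_int D * of_int m)"
proof -
  define S where "S = abc_support K a b c"
  have "1 \<le> 2 * D * m" using D_pos m(1) by (simp add: int_one_le_iff_zero_less)
  then have ge1: "1 \<le> (2 * of_int D * of_int m :: real)"
    by (metis of_int_1_le_iff of_int_mult of_int_numeral)
  have S: "S \<subseteq> finite_places K" by (auto simp: S_def abc_support_def)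
  have mS: "of_int m \<in> \<pp>" if "\<pp> \<in> S" for \<pp>
  proof -
    have p: "\<pp> \<in> finite_places K" using that S by blast
    interpret finite_place D \<pp> using p by (rule finite_placeI)
    have "valuation K \<pp> c \<noteq> 0"
      using that unit[OF p] by (auto simp: S_def abc_support_def)
    then show ?thesis using valuation_eq_0[OF c] m(2)[OF p] by blast
  qed
  \<comment> \<open>A sum over an infinite set is 0 by convention, so only a finite support needs an argument.\<close>
  have "(\<Sum>\<pp>\<in>S. ln (real (ideal_norm K \<pp>))) \<le> 2 * ln (2 * of_int D * of_int m)"
  proof (cases "finite S")
    case True
    have pos: "ideal_norm K \<pp> > 0" if "\<pp> \<in> S" for \<pp>
      using that S finite_place.ideal_norm_pos[OF finite_placeI] by blast
    have "(\<Sum>\<pp>\<in>S. ln (real (ideal_norm K \<pp>))) = ln (\<Prod>\<pp>\<in>S. real (ideal_norm K \<pp>))"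
      using True pos by (intro ln_prod[symmetric]) auto
    also have "\<dots> \<le> ln ((2 * of_int D * of_int m)\<^sup>2)"
    proof (rule ln_mono)
      show "0 < (\<Prod>\<pp>\<in>S. real (ideal_norm K \<pp>))" using pos by (intro prod_pos) auto
      have "real_of_int (int (\<Prod>\<pp>\<in>S. ideal_norm K \<pp>)) \<le> of_int ((2 * D * m)\<^sup>2)"
        using prod_ideal_norm_le[OF True S m(1) mS] by (simp only: of_int_le_iff)
      then show "(\<Prod>\<pp>\<in>S. real (ideal_norm K \<pp>)) \<le> (2 * of_int D * of_int m)\<^sup>2" by simp
    qed
    also have "\<dots> = 2 * ln (2 * of_int D * of_int m)"
      using ge1 by (simp add: ln_realpow)
    finally show ?thesis .
  qed (use ge1 in auto)
  then show ?thesis unfolding abc_radical_def field_degree_eq S_def by simp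
qed

end

section \<open>Lucas sequences\<close>

lemma lucas_U_add:
  "lucas_U P Q (m + Suc n) = lucas_U P Q (Suc m) * lucas_U P Q (Suc n) + Q * lucas_U P Q m * lucas_U P Q n"
proof (induction P Q m arbitrary: n rule: lucas_U.induct)
  case (3 P Q m)
  have "lucas_U P Q (Suc (Suc m) + Suc n) = P * lucas_U P Q (Suc m + Suc n) + Q * lucas_U P Q (m + Suc n)"
    by simp
  then show ?case unfolding 3 by (simp add: algebra_simps)
qed auto

lemma coprime_lucas_U_Suc:
  assumes "Q = 1 \<or> Q = -1" shows "coprime (lucas_U P Q n) (lucas_U P Q (Suc n))"
proof (induction n)
  case (Suc n)
  have "d dvd lucas_U P Q n" if "d dvd lucas_U P Q (Suc n)" "d dvd lucas_U P Q (Suc (Suc n))" for d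
  proof -
    have "d dvd Q * lucas_U P Q n" 
      using that by (metis add_diff_cancel_left' dvd_diff dvd_mult lucas_U.simps(3))
    then show ?thesis using assms by auto
  qed
  then show ?case using Suc by (meson coprime_def)
qed simp

lemma coprime_lucas_U:
  assumes Q: "Q = 1 \<or> Q = -1" and "coprime m n"
  shows "coprime (lucas_U P Q m) (lucas_U P Q n)"
  using assms(2)
proof (induction "m + n" arbitrary: m n rule: less_induct)
  case less
  have step: "coprime (lucas_U P Q m) (lucas_U P Q n)"
    if mn: "m \<le> n" "coprime m n" and m: "m > 0" 
    and IH: "\<And>k. m + k < m + n \<Longrightarrow> coprime m k \<Longrightarrow> coprime (lucas_U P Q m) (lucas_U P Q k)" for m n
  proof (cases "n = m")
    case True
    then show ?thesis using mn by simp
  next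
    case False
    then obtain k where k: "n = m + Suc k" using mn(1) by (metis le_neq_implies_less less_iff_Suc_add add_Suc_right)
    have "coprime m (Suc k)" using mn(2) k by (metis add.commute coprime_iff_gcd_eq_1 gcd_add2)
    then have "coprime (lucas_U P Q m) (lucas_U P Q (Suc k))" using IH k m by auto
    then have "coprime (lucas_U P Q m) (lucas_U P Q (Suc m) * lucas_U P Q (Suc k))"
      using coprime_lucas_U_Suc[OF Q] by simp
    moreover have "lucas_U P Q n = lucas_U P Q (Suc m) * lucas_U P Q (Suc k) + lucas_U P Q m * (Q * lucas_U P Q k)"
      unfolding k lucas_U_add by simp
    ultimately show ?thesis
      by (metis (no_types) add.commute coprime_iff_gcd_eq_1 gcd_add_mult mult.commute)
  qed
  consider "m = 0" | "n = 0" | "m > 0" "n > 0" "m \<le> n" | "m > 0" "n > 0" "n \<le> m" by linarith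
  then show ?case
  proof cases
    case 3 then show ?thesis using step[of m n] less by auto
  next
    case 4 
    then show ?thesis using step[of n m] less by (auto simp: coprime_commute add.commute)
  qed (use less.prems in auto)
qed

lemma nondegenerate_imp_P_nonzero:
  assumes "Q = 1 \<or> Q = -1" "P\<^sup>2 + 4 * Q > 0" "lucas_nondegenerate P Q"
  shows "P \<noteq> 0"
proof
  assume "P = 0"
  then have "Q = 1" using assms by auto
  have "\<forall>x :: complex. x\<^sup>2 - of_int P * x - of_int Q = (x - 1) * (x - (-1))"
    unfolding \<open>P = 0\<close> \<open>Q = 1\<close> by (simp add: power2_eq_square algebra_simps)
  then have "\<not> (\<exists>k::nat. k > 0 \<and> (1 / (-1 :: complex)) ^ k = 1)"
    using assms(3) unfolding lucas_nondegenerate_def by blast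
  moreover have "(1 / (-1 :: complex)) ^ 2 = 1" by simp
  ultimately show False using zero_less_numeral by blast
qed

text \<open>
  A square of the same parity as \<open>P\<^sup>2\<close> and different from it is at least \<open>(\<bar>P\<bar> + 2)\<^sup>2 > P\<^sup>2 + 4\<close>
  or at most \<open>(\<bar>P\<bar> - 2)\<^sup>2\<close>, and the latter reaches \<open>P\<^sup>2 - 4\<close> only if \<open>\<bar>P\<bar> \<le> 2\<close>, when the
  discriminant for \<open>Q = -1\<close> is not positive.
\<close>

lemma discriminant_not_square:
  fixes P Q s :: int
  assumes "Q = 1 \<or> Q = -1" "P\<^sup>2 + 4 * Q > 0" "P \<noteq> 0"
  shows "P\<^sup>2 + 4 * Q \<noteq> s\<^sup>2"
proof
  assume *: "P\<^sup>2 + 4 * Q = s\<^sup>2"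
  define p where "p = \<bar>P\<bar>"
  define t where "t = \<bar>s\<bar>"
  have eq: "p * p + 4 * Q = t * t" "p \<ge> 1" "t \<ge> 0" 
    using * assms(3) by (auto simp: p_def t_def power2_eq_square)
  have "even (p * p + 4 * Q) \<longleftrightarrow> even (t * t)" using eq by simp
  then have par: "even p \<longleftrightarrow> even t" by simp
  show False
  proof (cases "Q = 1")
    case True
    have "t > p" using eq True by (smt (verit) mult_mono)
    then have "t \<ge> p + 2" using par by presburger
    then have "t * t \<ge> (p + 2) * (p + 2)" using eq by (intro mult_mono) auto
    then show False using eq True by (simp add: algebra_simps)
  next
    case False
    then have Q: "Q = -1" using assms by simp
    have "t < p" using eq Q by (smt (verit) mult_mono)
    then have "t + 2 \<le> p" using par by presburger
    then have "(t + 2) * (t + 2) \<le> p * p" using eq by (intro mult_mono) auto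
    then have "t = 0" using eq Q by (simp add: algebra_simps)
    then show False using assms * t_def by simp
  qed
qed

lemma sqrt_discriminant_irrational:
  fixes P Q :: int
  assumes "Q = 1 \<or> Q = -1" "P\<^sup>2 + 4 * Q > 0" "P \<noteq> 0"
  shows "sqrt (of_int (P\<^sup>2 + 4 * Q)) \<notin> \<rat>"
proof
  assume "sqrt (of_int (P\<^sup>2 + 4 * Q)) \<in> \<rat>"
  moreover have "algebraic_int (sqrt (of_int (P\<^sup>2 + 4 * Q)))"
    by (intro algebraic_int_sqrt int_imp_algebraic_int Ints_of_int)
  ultimately obtain s where s: "sqrt (of_int (P\<^sup>2 + 4 * Q)) = of_int s"
    using rational_algebraic_int_is_int by (metis Ints_cases)
  have "real_of_int (P\<^sup>2 + 4 * Q) = (sqrt (of_int (P\<^sup>2 + 4 * Q)))\<^sup>2"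
    using assms(2) by (subst real_sqrt_pow2) (auto simp del: of_int_add of_int_mult)
  also have "\<dots> = of_int (s\<^sup>2)" unfolding s by simp
  finally have "P\<^sup>2 + 4 * Q = s\<^sup>2" by (simp only: of_int_eq_iff)
  then show False using discriminant_not_square[OF assms] by blast
qed

text \<open>
  Here \<open>P \<noteq> 0\<close> stands for nondegeneracy, from which it follows
  (lemma \<open>nondegenerate_imp_P_nonzero\<close>). The quadratic field is that of the discriminant.
\<close>

locale real_lucas =
  fixes P Q :: int
  assumes Q_unit: "Q = 1 \<or> Q = -1"
    and discriminant_pos: "P\<^sup>2 + 4 * Q > 0"
    and P_nonzero: "P \<noteq> 0"
begin

abbreviation "\<Delta> \<equiv> P\<^sup>2 + 4 * Q"

sublocale real_quadratic_field \<Delta>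
  using discriminant_pos sqrt_discriminant_irrational[OF Q_unit discriminant_pos P_nonzero]
  by unfold_locales

text \<open>
  The two roots of \<open>x\<^sup>2 - P x - Q\<close>; they are conjugate in \<open>K\<close>.
\<close>

definition \<alpha> :: real where "\<alpha> = (of_int P + w) / 2"
definition \<beta> :: real where "\<beta> = (of_int P - w) / 2"

lemma root_sum: "\<alpha> + \<beta> = of_int P" and root_diff: "\<alpha> - \<beta> = w" 
  by (simp_all add: \<alpha>_def \<beta>_def field_simps)

lemma root_prod: "\<alpha> * \<beta> = - of_int Q"
proof -
  have "4 * (\<alpha> * \<beta>) = of_int P * of_int P - w * w" by (simp add: \<alpha>_def \<beta>_def algebra_simps)
  then show ?thesis unfolding w_sq by (simp add: power2_eq_square)
qed

lemma root_eq: "\<alpha>\<^sup>2 = of_int P * \<alpha> + of_int Q" "\<beta>\<^sup>2 = of_int P * \<beta> + of_int Q"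
  unfolding root_sum[symmetric] using root_prod by (simp_all add: power2_eq_square algebra_simps)

lemma binet: "w * of_int (lucas_U P Q n) = \<alpha> ^ n - \<beta> ^ n"
proof -
  have "w * of_int (lucas_U P Q n) = \<alpha> ^ n - \<beta> ^ n \<and> 
        w * of_int (lucas_U P Q (Suc n)) = \<alpha> ^ Suc n - \<beta> ^ Suc n"
  proof (induction n)
    case 0
    then show ?case by (simp add: root_diff)
  next
    case (Suc n)
    have "w * of_int (lucas_U P Q (Suc (Suc n))) = 
        of_int P * (w * of_int (lucas_U P Q (Suc n))) + of_int Q * (w * of_int (lucas_U P Q n))"
      by (simp add: algebra_simps)
    also have "\<dots> = of_int P * (\<alpha> ^ Suc n - \<beta> ^ Suc n) + of_int Q * (\<alpha> ^ n - \<beta> ^ n)"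
      using Suc by simp
    also have "\<dots> = \<alpha> ^ n * \<alpha>\<^sup>2 - \<beta> ^ n * \<beta>\<^sup>2"
      unfolding root_eq by (simp add: algebra_simps)
    finally show ?case using Suc by (simp add: power2_eq_square algebra_simps)
  qed
  then show ?thesis by simp
qed

text \<open>
  The absolute value of the dominant root, which governs the growth of the sequence.
\<close>

definition M :: real where "M = max \<bar>\<alpha>\<bar> \<bar>\<beta>\<bar>"

lemma abs_root_prod: "\<bar>\<alpha>\<bar> * \<bar>\<beta>\<bar> = 1"
  using Q_unit root_prod by (auto simp flip: abs_mult)

lemma abs_roots_distinct: "\<bar>\<alpha>\<bar> \<noteq> \<bar>\<beta>\<bar>"
proof -
  have "\<alpha> * \<alpha> - \<beta> * \<beta> = (\<alpha> + \<beta>) * (\<alpha> - \<beta>)" by (simp add: algebra_simps)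
  also have "\<dots> \<noteq> 0" unfolding root_sum root_diff using w_pos P_nonzero by simp
  finally show ?thesis by (metis abs_mult_self_eq eq_iff_diff_eq_0)
qed

lemma M_gt_1: "M > 1"
proof (rule ccontr)
  assume "\<not> M > 1"
  then have "\<bar>\<alpha>\<bar> \<le> 1" "\<bar>\<beta>\<bar> \<le> 1" by (auto simp: M_def)
  then have "\<bar>\<alpha>\<bar> * \<bar>\<beta>\<bar> \<le> \<bar>\<alpha>\<bar> * 1" "\<bar>\<alpha>\<bar> * \<bar>\<beta>\<bar> \<le> 1 * \<bar>\<beta>\<bar>" by (intro mult_mono; simp)+
  then show False using abs_root_prod abs_roots_distinct \<open>\<bar>\<alpha>\<bar> \<le> 1\<close> \<open>\<bar>\<beta>\<bar> \<le> 1\<close> by simp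
qed

lemma M_power: "max \<bar>\<alpha> ^ n\<bar> \<bar>\<beta> ^ n\<bar> = M ^ n"
  unfolding M_def power_abs
  by (cases "\<bar>\<alpha>\<bar> \<le> \<bar>\<beta>\<bar>") (auto simp: max_def power_mono intro: antisym)

lemma lucas_U_nonzero:
  assumes "n > 0" shows "lucas_U P Q n \<noteq> 0"
proof
  assume "lucas_U P Q n = 0"
  then have "\<alpha> ^ n = \<beta> ^ n" using binet[of n] by simp
  then have "\<bar>\<alpha>\<bar> ^ n = \<bar>\<beta>\<bar> ^ n" by (simp flip: power_abs)
  then show False using abs_roots_distinct assms by (meson abs_ge_zero power_eq_imp_eq_base)
qed

lemma abs_lucas_U_le: "\<bar>of_int (lucas_U P Q n)\<bar> \<le> 2 * M ^ n"
proof -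
  have "1 \<le> \<Delta>" using discriminant_pos by simp
  then have "1 \<le> (of_int \<Delta> :: real)" by (simp only: of_int_1_le_iff)
  then have "1 \<le> w" by (rule real_sqrt_ge_one)
  then have "\<bar>of_int (lucas_U P Q n)\<bar> \<le> w * \<bar>of_int (lucas_U P Q n)\<bar>"
    by (simp add: mult_le_cancel_right1)
  also have "\<dots> = \<bar>\<alpha> ^ n - \<beta> ^ n\<bar>" using binet[of n] w_pos by (simp add: abs_mult flip: binet)
  also have "\<dots> \<le> \<bar>\<alpha> ^ n\<bar> + \<bar>\<beta> ^ n\<bar>" by simp
  also have "\<dots> \<le> 2 * M ^ n" using M_power[of n] by linarith
  finally show ?thesis .
qed

lemma roots_in_K: "\<alpha> \<in> K" "\<beta> \<in> K" and conjugate_roots: "conjugate \<alpha> = \<beta>" "conjugate \<beta> = \<alpha>"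
proof -
  have a: "\<alpha> = of_rat (of_int P / 2) + of_rat (1 / 2) * w" by (simp add: \<alpha>_def of_rat_divide field_simps)
  have b: "\<beta> = of_rat (of_int P / 2) + of_rat (-1 / 2) * w" 
    by (simp add: \<beta>_def of_rat_divide of_rat_minus field_simps)
  show "\<alpha> \<in> K" "\<beta> \<in> K" unfolding a b by (rule in_K)+
  have "conjugate \<alpha> = of_rat (of_int P / 2) - of_rat (1 / 2) * w"
    unfolding a by (rule conjugate_coordinates)
  also have "\<dots> = \<beta>" by (simp add: b of_rat_divide of_rat_minus)
  finally show "conjugate \<alpha> = \<beta>" .
  have "conjugate \<beta> = of_rat (of_int P / 2) - of_rat (-1 / 2) * w"
    unfolding b by (rule conjugate_coordinates)
  also have "\<dots> = \<alpha>" by (simp add: a of_rat_divide of_rat_minus)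
  finally show "conjugate \<beta> = \<alpha>" .
qed

lemma roots_in_OK: "\<alpha> \<in> OK" "\<beta> \<in> OK"
proof -
  have "algebraic_int x" if "x\<^sup>2 = of_int P * x + of_int Q" for x :: real
  proof (rule algebraic_int.intros[of "[:- of_int Q, - of_int P, 1:]"])
    show "\<forall>i. coeff [:- of_int Q, - of_int P, 1:] i \<in> (\<int> :: real set)"
      by (auto simp: coeff_pCons split: nat.split)
    show "poly [:- of_int Q, - of_int P, 1:] x = 0" 
      using that by (simp add: power2_eq_square algebra_simps)
  qed simp
  then show "\<alpha> \<in> OK" "\<beta> \<in> OK" using root_eq roots_in_K by auto
qed

section \<open>Bounding the index by the abc conjecture\<close>

text \<open>
  Since \<open>\<alpha> * \<beta> = - Q\<close> and \<open>Q\<^sup>2 = 1\<close>, the inverse of \<open>\<alpha>\<close> is \<open>- Q * \<beta>\<close>, an integer of \<open>K\<close>, and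
  likewise for \<open>\<beta>\<close>.
\<close>

lemma root_powers_units:
  assumes "\<pp> \<in> finite_places K"
  shows "valuation K \<pp> (\<alpha> ^ n) = 0" "valuation K \<pp> (- (\<beta> ^ n)) = 0" "finite_abs K \<pp> (\<alpha> ^ n) = 1"
proof -
  interpret finite_place \<Delta> \<pp> using assms by (rule finite_placeI)
  have mi: "- of_int Q \<in> OK" "(-1) \<in> OK" using of_int_in_OK[of "-Q"] of_int_in_OK[of "-1"] by simp_all
  have Q2: "- of_int Q * - of_int Q = (1 :: real)" using Q_unit by auto
  have eq: "\<alpha> ^ n * (- of_int Q * \<beta>) ^ n = 1" "- (\<beta> ^ n) * - ((- of_int Q * \<alpha>) ^ n) = 1"
  proof -
    have "\<alpha> * (- of_int Q * \<beta>) = 1" "\<beta> * (- of_int Q * \<alpha>) = 1"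
      using root_prod Q2 by (simp_all add: algebra_simps)
    then show "\<alpha> ^ n * (- of_int Q * \<beta>) ^ n = 1" "- (\<beta> ^ n) * - ((- of_int Q * \<alpha>) ^ n) = 1"
      by (simp_all only: minus_mult_minus power_mult_distrib[symmetric] power_one)
  qed
  have neg: "- x \<in> OK" if "x \<in> OK" for x using OK_mult[OF mi(2) that] by simp
  have mem: "\<alpha> ^ n \<in> OK" "(- of_int Q * \<beta>) ^ n \<in> OK" "- (\<beta> ^ n) \<in> OK" "- ((- of_int Q * \<alpha>) ^ n) \<in> OK"
    by (intro neg OK_power OK_mult mi roots_in_OK)+
  show "valuation K \<pp> (\<alpha> ^ n) = 0" "valuation K \<pp> (- (\<beta> ^ n)) = 0"
    using valuation_eq_0 unit_notin_place mem eq by blast+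
  show "finite_abs K \<pp> (\<alpha> ^ n) = 1" using finite_abs_unit mem eq by blast
qed

text \<open>
  With \<open>w U\<^sub>n\<close> the prime contains \<open>(\<Delta> z)\<^sup>2 = \<Delta> d w (w U\<^sub>n)\<close>. Passing from \<open>z\<^sup>2\<close> to \<open>z\<close> is what
  makes the radical only half as large as the height.
\<close>

lemma place_contains_discriminant_times_root:
  assumes p: "\<pp> \<in> finite_places K" and dz: "d * lucas_U P Q n = z\<^sup>2"
    and c: "w * of_int (lucas_U P Q n) \<in> \<pp>"
  shows "of_int (\<Delta> * \<bar>z\<bar>) \<in> \<pp>"
proof -
  interpret finite_place \<Delta> \<pp> using p by (rule finite_placeI)
  have "w * of_int (lucas_U P Q n) * (w * of_int (d * \<Delta>)) \<in> \<pp>"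
    using place_closed(4)[OF c] OK_mult[OF w_in_OK of_int_in_OK] by blast
  also have "w * of_int (lucas_U P Q n) * (w * of_int (d * \<Delta>)) = (w * w) * of_int (d * lucas_U P Q n) * of_int \<Delta>"
    by (simp only: of_int_mult mult_ac)
  also have "\<dots> = of_int \<Delta> * of_int (z\<^sup>2) * of_int \<Delta>" by (simp only: dz w_sq)
  also have "\<dots> = (of_int (\<Delta> * \<bar>z\<bar>))\<^sup>2"
    by (simp only: of_int_mult of_int_power power_mult_distrib of_int_abs power2_abs power2_eq_square mult_ac abs_mult_self_eq abs_mult)
  finally show ?thesis using place_power of_int_in_OK by blast
qed

text \<open>
  With \<open>\<epsilon> = 1/2\<close> the conjecture gives \<open>n ln M \<le> (3/2) ln (2 \<Delta>\<^sup>2 \<bar>z\<bar>) + C\<close>, while \<open>z\<^sup>2 = d U\<^sub>n\<close> gives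
  \<open>2 ln \<bar>z\<bar> \<le> ln (2 A) + n ln M\<close>. Together they yield \<open>(1/4) n ln M \<le> E\<close> with a constant \<open>E\<close>.
\<close>

lemma abc_imp_square_class_index_bounded:
  assumes abc: "abc_conjecture K"
  shows "\<exists>B. \<forall>n d z. n > 0 \<longrightarrow> d \<noteq> 0 \<longrightarrow> \<bar>d\<bar> \<le> A \<longrightarrow> d * lucas_U P Q n = z\<^sup>2 \<longrightarrow> real n \<le> B"
proof -
  obtain C where C: "\<And>a b c. a \<in> K - {0} \<Longrightarrow> b \<in> K - {0} \<Longrightarrow> c \<in> K - {0} \<Longrightarrow> a + b = c \<Longrightarrow>
     abc_height K a b c \<le> (1 + 1 / 2) * abc_radical K a b c + C"
    using abc unfolding abc_conjecture_def by (metis zero_less_divide_1_iff zero_less_numeral)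
  define L where "L = ln M"
  have L: "L > 0" unfolding L_def using M_gt_1 by simp
  define lnD where "lnD = ln (2 * real_of_int \<Delta> * of_int \<Delta>)"
  define lnA where "lnA = ln (2 * real_of_int A)"
  define E where "E = 3 / 2 * lnD + 3 / 4 * lnA + C"
  have "real n \<le> 4 * E / L" if n: "n > 0" and d: "d \<noteq> 0" "\<bar>d\<bar> \<le> A" and dz: "d * lucas_U P Q n = z\<^sup>2" for n d z
  proof -
    let ?U = "lucas_U P Q n"
    define a where "a = \<alpha> ^ n"
    define b where "b = - (\<beta> ^ n)"
    define c where "c = w * of_int ?U"
    have U: "?U \<noteq> 0" using lucas_U_nonzero n by simp
    have z: "z \<noteq> 0" using dz d U by auto
    have K: "a \<in> K" "b \<in> K" "c \<in> K"
      unfolding a_def b_def c_def by (intro K_power K_uminus K_mult roots_in_K w_in_K of_int_in_K)+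
    have nz: "a \<noteq> 0" "b \<noteq> 0" "c \<noteq> 0"
      using abs_root_prod U w_pos by (auto simp: a_def b_def c_def)
    have conj: "\<bar>conjugate a\<bar> = \<bar>b\<bar>" "\<bar>conjugate b\<bar> = \<bar>a\<bar>"
    proof -
      show "\<bar>conjugate a\<bar> = \<bar>b\<bar>"
        unfolding a_def b_def by (simp add: conjugate_power roots_in_K conjugate_roots)
      have "conjugate b = conjugate (of_int (-1)) * conjugate (\<beta> ^ n)"
        unfolding b_def by (subst conjugate_mult[symmetric]) (simp_all add: K_power roots_in_K K_uminus)
      then show "\<bar>conjugate b\<bar> = \<bar>a\<bar>"
        unfolding a_def by (simp only: conjugate_of_int) (simp add: conjugate_power roots_in_K conjugate_roots)
    qed
    have cOK: "c \<in> OK"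
    proof -
      \<comment> \<open>Up to sign, \<open>c\<close> is the square root of the integer \<open>\<Delta> U\<^sub>n\<^sup>2\<close>.\<close>
      have "algebraic_int (sqrt (of_int (\<Delta> * ?U\<^sup>2)) :: real)"
        by (intro algebraic_int_sqrt int_imp_algebraic_int Ints_of_int)
      also have "sqrt (of_int (\<Delta> * ?U\<^sup>2)) = \<bar>c\<bar>"
        using w_pos by (simp add: c_def real_sqrt_mult abs_mult)
      finally show ?thesis using K by simp
    qed
    have "real n * L = ln (max \<bar>a\<bar> \<bar>b\<bar>)"
      using M_power[of n] M_gt_1 by (simp add: a_def b_def L_def ln_realpow)
    also have "\<dots> \<le> abc_height K a b c"
      using K nz conj root_powers_units(3) by (intro abc_height_ge) (auto simp: a_def)
    also have "\<dots> \<le> (1 + 1 / 2) * abc_radical K a b c + C"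
    proof (rule C)
      show "a + b = c" unfolding a_def b_def c_def using binet[of n] by linarith
    qed (use K nz in auto)
    also have "abc_radical K a b c \<le> ln (2 * of_int \<Delta> * of_int (\<Delta> * \<bar>z\<bar>))"
    proof (rule abc_radical_le)
      show "0 < \<Delta> * \<bar>z\<bar>" using z discriminant_pos by simp
    qed (use cOK place_contains_discriminant_times_root[OF _ dz] root_powers_units(1,2) in \<open>simp_all add: a_def b_def c_def del: ring_of_ints_simps\<close>)
    also have "ln (2 * real_of_int \<Delta> * of_int (\<Delta> * \<bar>z\<bar>)) = ln (2 * of_int \<Delta> * of_int \<Delta>) + ln (of_int \<bar>z\<bar>)"
    proof -
      have "ln (2 * real_of_int \<Delta> * of_int (\<Delta> * \<bar>z\<bar>)) = ln ((2 * of_int \<Delta> * of_int \<Delta>) * real_of_int \<bar>z\<bar>)"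
        by (simp only: of_int_mult mult_ac)
      also have "\<dots> = ln (2 * of_int \<Delta> * of_int \<Delta>) + ln (of_int \<bar>z\<bar>)"
      proof (rule ln_mult_pos)
        have "real_of_int \<Delta> > 0" using discriminant_pos by (simp only: of_int_0_less_iff)
        then show "0 < 2 * real_of_int \<Delta> * real_of_int \<Delta>" by (intro mult_pos_pos) auto
      qed (use z in simp)
      finally show ?thesis .
    qed
    finally have main: "real n * L \<le> (1 + 1 / 2) * (lnD + ln (of_int \<bar>z\<bar>)) + C"
      unfolding lnD_def by simp
    have arith: "s \<le> 4 * (3 / 2 * u + 3 / 4 * v + e)"
      if "2 * t \<le> v + s" "s \<le> 3 / 2 * (u + t) + e" for s t u v e :: real
      using that by argo
    have three_halves: "1 + 1 / 2 = (3 / 2 :: real)" by simp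
    have "0 < real_of_int \<bar>z\<bar>" using z by simp
    then have "2 * ln (of_int \<bar>z\<bar>) = ln ((of_int \<bar>z\<bar>)\<^sup>2 :: real)"
      using ln_realpow[of "real_of_int \<bar>z\<bar>" 2] by (simp only: of_nat_numeral)
    also have "(real_of_int \<bar>z\<bar>)\<^sup>2 = of_int (z\<^sup>2)" by simp
    also have "(of_int (z\<^sup>2) :: real) = \<bar>of_int d\<bar> * \<bar>of_int ?U\<bar>" 
    proof -
      have "(of_int (z\<^sup>2) :: real) = \<bar>of_int (z\<^sup>2)\<bar>" by simp
      then show ?thesis unfolding dz[symmetric] by (simp only: of_int_mult abs_mult)
    qed
    also have "ln (\<bar>of_int d\<bar> * \<bar>of_int ?U\<bar> :: real) \<le> ln (of_int A * (2 * M ^ n))"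
    proof (rule ln_mono)
      show "\<bar>of_int d\<bar> * \<bar>of_int ?U\<bar> \<le> of_int A * (2 * M ^ n)"
        using d abs_lucas_U_le[of n] by (intro mult_mono) (simp_all flip: of_int_abs)
    qed (use d U in auto)
    also have "real_of_int A * (2 * M ^ n) = (2 * of_int A) * M ^ n" by simp
    also have "ln ((2 * real_of_int A) * M ^ n) = ln (2 * of_int A) + ln (M ^ n)"
      using d M_gt_1 by (intro ln_mult_pos) auto
    also have "ln (M ^ n) = real n * L" using M_gt_1 by (simp add: L_def ln_realpow)
    finally have "2 * ln (of_int \<bar>z\<bar>) \<le> lnA + real n * L" unfolding lnA_def .
    then have "real n * L \<le> 4 * E" using main unfolding E_def three_halves by (rule arith)
    then show ?thesis using L by (simp add: field_simps)
  qed
  then show ?thesis by blast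
qed

end

section \<open>Square classes\<close>

lemma rat_units_simps [simp]:
  "carrier rat_units = - {0}"
  "monoid.mult rat_units = (*)"
  "monoid.one rat_units = 1"
  by auto

lemma comm_group_rat_units: "comm_group rat_units"
proof (rule comm_groupI)
  fix x assume "x \<in> carrier rat_units"
  then show "\<exists>y\<in>carrier rat_units. y \<otimes>\<^bsub>rat_units\<^esub> x = \<one>\<^bsub>rat_units\<^esub>"
    by (intro bexI[of _ "inverse x"]) auto
qed auto

lemma nonzero_squares_eq: "nonzero_squares = {q\<^sup>2 | q. q \<noteq> 0}"
  by (auto simp: nonzero_squares_def)

lemma subgroup_nonzero_squares: "subgroup nonzero_squares rat_units"
proof -
  interpret G: comm_group rat_units by (rule comm_group_rat_units)
  show ?thesis
  proof (rule G.subgroupI)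
    show "nonzero_squares \<subseteq> carrier rat_units" "nonzero_squares \<noteq> {}"
      by (auto simp: nonzero_squares_eq intro: exI[of _ 1])
  next
    fix a assume "a \<in> nonzero_squares"
    then obtain q where q: "a = q\<^sup>2" "q \<noteq> 0" by (auto simp: nonzero_squares_eq)
    have "inv\<^bsub>rat_units\<^esub> a = (inverse q)\<^sup>2"
      using q by (intro G.inv_equality) (auto simp: field_simps)
    then show "inv\<^bsub>rat_units\<^esub> a \<in> nonzero_squares"
      using q by (auto simp: nonzero_squares_eq intro!: exI[of _ "inverse q"])
  next
    fix a b assume "a \<in> nonzero_squares" "b \<in> nonzero_squares"
    then obtain q r where "a = q\<^sup>2" "q \<noteq> 0" "b = r\<^sup>2" "r \<noteq> 0" by (auto simp: nonzero_squares_eq)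
    then have "a * b = (q * r)\<^sup>2" "q * r \<noteq> 0" by (auto simp: power_mult_distrib)
    then show "a \<otimes>\<^bsub>rat_units\<^esub> b \<in> nonzero_squares"
      unfolding nonzero_squares_eq rat_units_simps by blast
  qed
qed

lemma comm_group_sqclass: "comm_group sqclass_group"
  unfolding sqclass_group_def
  using comm_group.abelian_FactGroup[OF comm_group_rat_units subgroup_nonzero_squares] .

lemma sqclass_in_carrier: "x \<noteq> 0 \<Longrightarrow> sqclass x \<in> carrier sqclass_group"
  by (auto simp: sqclass_group_def sqclass_def carrier_FactGroup)

lemma sqclass_mult:
  assumes "x \<noteq> 0" "y \<noteq> 0"
  shows "sqclass x \<otimes>\<^bsub>sqclass_group\<^esub> sqclass y = sqclass (x * y)"
proof -
  interpret G: comm_group rat_units by (rule comm_group_rat_units)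
  have "nonzero_squares \<lhd> rat_units"
    using G.normal_iff_subgroup subgroup_nonzero_squares by blast
  then show ?thesis
    using normal.rcos_sum[of nonzero_squares rat_units x y] assms
    by (simp add: sqclass_group_def sqclass_def)
qed

lemma sqclass_eq_iff:
  assumes "x \<noteq> 0" "y \<noteq> 0"
  shows "sqclass x = sqclass y \<longleftrightarrow> (\<exists>q. q \<noteq> 0 \<and> x = q\<^sup>2 * y)"
proof -
  have coset: "sqclass z = {q\<^sup>2 * z | q. q \<noteq> 0}" for z
    unfolding sqclass_def r_coset_def nonzero_squares_eq rat_units_simps by blast
  show ?thesis
  proof
    assume "sqclass x = sqclass y"
    moreover have "1\<^sup>2 * x \<in> sqclass x" unfolding coset by (metis (mono_tags, lifting) mem_Collect_eq one_neq_zero)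
    ultimately show "\<exists>q. q \<noteq> 0 \<and> x = q\<^sup>2 * y" unfolding coset by auto
  next
    assume "\<exists>q. q \<noteq> 0 \<and> x = q\<^sup>2 * y"
    then obtain q where q: "q \<noteq> 0" "x = q\<^sup>2 * y" by blast
    show "sqclass x = sqclass y"
      unfolding coset
    proof (intro equalityI subsetI)
      fix z assume "z \<in> {r\<^sup>2 * x | r. r \<noteq> 0}"
      then obtain r where "r \<noteq> 0" "z = r\<^sup>2 * x" by blast
      then have "r * q \<noteq> 0" "z = (r * q)\<^sup>2 * y" using q by (auto simp: power_mult_distrib)
      then show "z \<in> {r\<^sup>2 * y | r. r \<noteq> 0}" by blast
    next
      fix z assume "z \<in> {r\<^sup>2 * y | r. r \<noteq> 0}"
      then obtain r where "r \<noteq> 0" "z = r\<^sup>2 * y" by blast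
      then have "r / q \<noteq> 0" "z = (r / q)\<^sup>2 * x" using q by (auto simp: power_divide)
      then show "z \<in> {r\<^sup>2 * x | r. r \<noteq> 0}" by blast
    qed
  qed
qed

lemma sqclass_one: "sqclass 1 = \<one>\<^bsub>sqclass_group\<^esub>"
proof -
  interpret G: comm_group sqclass_group by (rule comm_group_sqclass)
  have "sqclass 1 \<otimes>\<^bsub>sqclass_group\<^esub> sqclass 1 = sqclass 1" by (simp add: sqclass_mult)
  then show ?thesis using G.l_cancel_one'[of "sqclass 1" "sqclass 1"] sqclass_in_carrier[of 1] by auto
qed

lemma sqclass_inv:
  assumes "x \<noteq> 0" shows "inv\<^bsub>sqclass_group\<^esub> (sqclass x) = sqclass x"
proof -
  interpret G: comm_group sqclass_group by (rule comm_group_sqclass)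
  have "sqclass (x * x) = sqclass 1"
    using assms by (subst sqclass_eq_iff) (auto simp: power2_eq_square)
  then show ?thesis
    using assms sqclass_one by (intro G.inv_equality sqclass_in_carrier) (auto simp: sqclass_mult)
qed

lemma finprod_sqclass:
  assumes "finite I" "\<And>i. i \<in> I \<Longrightarrow> f i \<noteq> 0"
  shows "finprod sqclass_group (\<lambda>i. sqclass (f i)) I = sqclass (\<Prod>i\<in>I. f i)"
proof -
  interpret G: comm_group sqclass_group by (rule comm_group_sqclass)
  show ?thesis using assms
  proof induction
    case empty
    then show ?case by (simp add: sqclass_one)
  next
    case (insert j I)
    then have "finprod sqclass_group (\<lambda>i. sqclass (f i)) (insert j I) =
        sqclass (f j) \<otimes>\<^bsub>sqclass_group\<^esub> finprod sqclass_group (\<lambda>i. sqclass (f i)) I"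
      by (intro G.finprod_insert) (auto intro!: sqclass_in_carrier)
    then show ?case using insert by (simp add: sqclass_mult)
  qed
qed

lemma rat_square_int_imp_int:
  assumes "(r::rat)\<^sup>2 = of_int k" obtains z where "r = of_int z"
proof -
  have "(of_rat r :: real)\<^sup>2 = of_int k" using assms by (metis of_rat_of_int_eq of_rat_power)
  then have "\<bar>of_rat r :: real\<bar> = sqrt (of_int k)" by (metis real_sqrt_abs)
  moreover have "algebraic_int (sqrt (of_int k))" by (intro algebraic_int_sqrt int_imp_algebraic_int Ints_of_int)
  ultimately have "algebraic_int (of_rat r :: real)" by (metis algebraic_int_abs_real)
  then have "(of_rat r :: real) \<in> \<int>" by (intro rational_algebraic_int_is_int) auto
  then show ?thesis using that by (metis Ints_cases of_rat_eq_iff of_rat_of_int_eq)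
qed

text \<open>
  The classes of divisors of \<open>A\<close> are closed under products: for divisors \<open>d\<close>, \<open>e\<close> with greatest common
  divisor \<open>g\<close>, the cofactors \<open>d / g\<close> and \<open>e / g\<close> are coprime divisors of \<open>A\<close>, so their product
  divides \<open>A\<close>, and it differs from \<open>d * e\<close> by the square \<open>g\<^sup>2\<close>.
\<close>

lemma G_group_divisor:
  assumes "S \<in> G_group A"
  shows "\<exists>d. d dvd A \<and> d \<noteq> 0 \<and> S = sqclass (of_int d)"
proof -
  define H where "H = insert (sqclass (-1)) {sqclass (of_int p) | p. Factorial_Ring.prime p \<and> p dvd A}"
  have H: "\<exists>d. d dvd A \<and> d \<noteq> 0 \<and> h = sqclass (of_int d)" if "h \<in> H" for h
    using that unfolding H_def
  proof (elim insertE CollectE exE conjE)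
    assume "h = sqclass (-1)"
    then show ?thesis by (intro exI[of _ "-1"]) auto
  next
    fix p assume "h = sqclass (of_int p)" "Factorial_Ring.prime p" "p dvd A"
    then show ?thesis by (intro exI[of _ p]) auto
  qed
  have "S \<in> generate sqclass_group H" using assms by (simp add: G_group_def H_def)
  then show ?thesis
  proof induction
    case one
    show ?case by (intro exI[of _ 1]) (simp add: sqclass_one)
  next
    case (incl h)
    then show ?case by (rule H)
  next
    case (inv h)
    then obtain d where "d dvd A" "d \<noteq> 0" "h = sqclass (of_int d)" using H by blast
    then show ?case by (intro exI[of _ d]) (simp add: sqclass_inv)
  next
    case (eng h1 h2)
    then obtain d e where de: "d dvd A" "d \<noteq> 0" "h1 = sqclass (of_int d)"
      "e dvd A" "e \<noteq> 0" "h2 = sqclass (of_int e)" by blast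
    define g where "g = gcd d e"
    obtain d' e' where d': "d = g * d'" "e = g * e'" by (metis g_def gcd_dvd1 gcd_dvd2 dvdE)
    have nz: "g \<noteq> 0" "d' \<noteq> 0" "e' \<noteq> 0" using de d' by auto
    have "coprime d' e'"
      using nz d' g_def by (metis gcd_coprime mult.commute)
    moreover have "d' dvd A" "e' dvd A" using de d' by (metis dvd_mult_right)+
    ultimately have "d' * e' dvd A" by (intro divides_mult)
    moreover have "sqclass (of_int d) \<otimes>\<^bsub>sqclass_group\<^esub> sqclass (of_int e) = sqclass (of_int (d' * e'))"
      using de nz d' by (simp add: sqclass_mult sqclass_eq_iff)
        (auto intro!: exI[of _ "of_int g"] simp: power2_eq_square)
    ultimately show ?case using de nz by (intro exI[of _ "d' * e'"]) auto
  qed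
qed

lemma G_group_mult: "S \<in> G_group A \<Longrightarrow> S' \<in> G_group A \<Longrightarrow> S \<otimes>\<^bsub>sqclass_group\<^esub> S' \<in> G_group A"
  unfolding G_group_def by (rule generate.eng)

lemma multiplicity_times_square:
  fixes p A y :: int
  assumes "Factorial_Ring.prime p" "A \<noteq> 0" "y \<noteq> 0"
  shows "Factorial_Ring.multiplicity p (A * y\<^sup>2) =
    Factorial_Ring.multiplicity p A + 2 * Factorial_Ring.multiplicity p y"
  using assms prime_imp_prime_elem[OF assms(1)]
  by (subst prime_elem_multiplicity_mult_distrib)
     (auto simp: prime_elem_multiplicity_power_distrib)

text \<open>
  Remove prime factors one at a time: a prime dividing \<open>A\<close> contributes a generator, and any other
  prime occurs at least twice, so that its square can be split off without changing the class.
\<close>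

lemma even_multiplicity_imp_G_group:
  fixes x :: int
  assumes "x \<noteq> 0" "\<And>p. Factorial_Ring.prime p \<Longrightarrow> \<not> p dvd A \<Longrightarrow> even (Factorial_Ring.multiplicity p x)"
  shows "sqclass (of_int x) \<in> G_group A"
  using assms
proof (induction "nat \<bar>x\<bar>" arbitrary: x rule: less_induct)
  case less
  show ?case
  proof (cases "is_unit x")
    case True
    then have "x = 1 \<or> x = -1" by auto
    moreover have "sqclass 1 \<in> G_group A"
      unfolding G_group_def sqclass_one by (rule generate.one)
    moreover have "sqclass (-1) \<in> G_group A"
      unfolding G_group_def by (rule generate.incl) simp
    ultimately show ?thesis by auto
  next
    case False
    then obtain p where p: "Factorial_Ring.prime p" "p dvd x" using less.prems prime_divisorE by metis
    then obtain y where y: "x = p * y" by blast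
    have nz: "p \<noteq> 0" "y \<noteq> 0" using y less.prems by auto
    have p2: "p \<ge> 2" using p(1) by (rule prime_ge_2_int)
    have mult: "Factorial_Ring.multiplicity q x = (if q = p then 1 else 0) + Factorial_Ring.multiplicity q y"
      if "Factorial_Ring.prime q" for q
      using that p nz unfolding y
      by (subst prime_elem_multiplicity_mult_distrib) (auto simp: multiplicity_self prime_multiplicity_other)
    have small: "nat \<bar>y\<bar> < nat \<bar>x\<bar>" unfolding y using nz p2 by (simp add: abs_mult)
    show ?thesis
    proof (cases "p dvd A")
      case True
      have "sqclass (of_int y) \<in> G_group A"
      proof (rule less.hyps[OF small nz(2)])
        fix q assume q: "Factorial_Ring.prime q" "\<not> q dvd A"
        then show "even (Factorial_Ring.multiplicity q y)" 
          using less.prems(2)[OF q] mult[OF q(1)] True by (auto split: if_splits)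
      qed
      moreover have "sqclass (of_int p) \<in> G_group A"
        unfolding G_group_def using p True by (intro generate.incl) auto
      ultimately have "sqclass (of_int p) \<otimes>\<^bsub>sqclass_group\<^esub> sqclass (of_int y) \<in> G_group A"
        by (rule G_group_mult[rotated])
      then show ?thesis using nz by (simp add: sqclass_mult y)
    next
      case False
      then have "even (Suc (Factorial_Ring.multiplicity p y))" using less.prems(2)[OF p(1)] mult[OF p(1)] by simp
      then have "p dvd y" using not_dvd_imp_multiplicity_0[of p y] by (cases "p dvd y") auto
      then obtain t where t: "y = p * t" by blast
      have tnz: "t \<noteq> 0" using t nz by auto
      have mult': "Factorial_Ring.multiplicity q y = (if q = p then 1 else 0) + Factorial_Ring.multiplicity q t"
        if "Factorial_Ring.prime q" for q
        using that p nz tnz unfolding t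
        by (subst prime_elem_multiplicity_mult_distrib) (auto simp: multiplicity_self prime_multiplicity_other)
      have "nat \<bar>t\<bar> < nat \<bar>x\<bar>" using small unfolding t using tnz p2 by (simp add: abs_mult) 
          (smt (verit) mult_le_cancel_right1)
      moreover have "even (Factorial_Ring.multiplicity q t)" if "Factorial_Ring.prime q" "\<not> q dvd A" for q
        using less.prems(2)[OF that] mult[OF that(1)] mult'[OF that(1)] by (auto split: if_splits)
      ultimately have "sqclass (of_int t) \<in> G_group A" using less.hyps tnz by blast
      moreover have "sqclass (of_int x) = sqclass (of_int t)"
        using less.prems tnz nz by (subst sqclass_eq_iff) (auto intro!: exI[of _ "of_int p"] simp: y t power2_eq_square)
      ultimately show ?thesis by simp
    qed
  qed
qed

lemma T_set_square:
  assumes A: "A \<noteq> 0" and n: "n \<in> T_set P Q A" and U: "lucas_U P Q n \<noteq> 0"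
  shows "\<exists>d z. d \<noteq> 0 \<and> \<bar>d\<bar> \<le> \<bar>A\<bar> \<and> d * lucas_U P Q n = z\<^sup>2"
proof -
  let ?U = "lucas_U P Q n"
  obtain d where d: "d dvd A" "d \<noteq> 0" "sqclass (of_int ?U) = sqclass (of_int d)"
    using G_group_divisor[of "sqclass (of_int ?U)" A] n by (auto simp: T_set_def)
  then obtain q :: rat where q: "of_int ?U = q\<^sup>2 * of_int d" using U by (auto simp: sqclass_eq_iff)
  then have "(q * of_int d)\<^sup>2 = of_int (d * ?U)" by (simp add: power2_eq_square)
  then obtain z where "q * of_int d = of_int z" by (rule rat_square_int_imp_int)
  then have "of_int (d * ?U) = (of_int (z\<^sup>2) :: rat)" using \<open>(q * of_int d)\<^sup>2 = of_int (d * ?U)\<close> by simp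
  then have "d * ?U = z\<^sup>2" by (simp only: of_int_eq_iff)
  moreover have "\<bar>d\<bar> \<le> \<bar>A\<bar>" using d A by (simp add: dvd_imp_le_int)
  ultimately show ?thesis using d by blast
qed

section \<open>The index set and products of Lucas numbers\<close>

context real_lucas
begin

lemma finite_T_set:
  assumes "abc_conjecture K" "A \<noteq> 0" shows "finite (T_set P Q A)"
proof -
  obtain B where B: "\<And>n d z. n > 0 \<Longrightarrow> d \<noteq> 0 \<Longrightarrow> \<bar>d\<bar> \<le> \<bar>A\<bar> \<Longrightarrow> d * lucas_U P Q n = z\<^sup>2 \<Longrightarrow> real n \<le> B"
    using abc_imp_square_class_index_bounded[OF assms(1), of "\<bar>A\<bar>"] by blast
  have "T_set P Q A \<subseteq> {..nat \<lfloor>B\<rfloor>}"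
  proof
    fix n assume n: "n \<in> T_set P Q A"
    then have "n > 0" by (auto simp: T_set_def)
    then have "real n \<le> B" using T_set_square[OF assms(2) n lucas_U_nonzero] B by blast
    then show "n \<in> {..nat \<lfloor>B\<rfloor>}" by (simp add: le_nat_floor)
  qed
  then show ?thesis by (rule finite_subset) simp
qed

lemma square_product_imp_clique:
  assumes A: "A \<noteq> 0" and I: "finite I" and pos: "\<And>i. i \<in> I \<Longrightarrow> n i > 0"
    and cop: "\<And>i j. i \<in> I \<Longrightarrow> j \<in> I \<Longrightarrow> i \<noteq> j \<Longrightarrow> coprime (n i) (n j)"
    and y: "A * y\<^sup>2 = (\<Prod>i\<in>I. lucas_U P Q (n i))"
  shows "is_coprimality_clique (T_set P Q A) {n i | i. i \<in> I \<and> n i \<noteq> 1}"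
proof -
  let ?U = "\<lambda>i. lucas_U P Q (n i)"
  have nz: "?U i \<noteq> 0" if "i \<in> I" for i using lucas_U_nonzero pos that by blast
  have "y \<noteq> 0" using y nz I by auto
  have T: "n i \<in> T_set P Q A" if i: "i \<in> I" "n i \<noteq> 1" for i
  proof -
    have "sqclass (of_int (?U i)) \<in> G_group A"
    proof (rule even_multiplicity_imp_G_group[OF nz[OF i(1)]])
      fix p :: int assume p: "Factorial_Ring.prime p" "\<not> p dvd A"
      show "even (Factorial_Ring.multiplicity p (?U i))"
      proof (cases "p dvd ?U i")
        case True
        have "Factorial_Ring.multiplicity p (?U j) = 0" if j: "j \<in> I - {i}" for j
        proof -
          have "coprime (?U i) (?U j)" using j i cop by (intro coprime_lucas_U Q_unit) auto
          then have "\<not> p dvd ?U j" using True p(1) not_prime_unit coprime_common_divisor by blast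
          then show ?thesis by (rule not_dvd_imp_multiplicity_0)
        qed
        then have "Factorial_Ring.multiplicity p (?U i) = (\<Sum>j\<in>I. Factorial_Ring.multiplicity p (?U j))"
          using I i by (subst sum.remove[of _ i]) auto
        also have "\<dots> = Factorial_Ring.multiplicity p (\<Prod>j\<in>I. ?U j)"
          using p I nz by (intro prime_elem_multiplicity_prod_distrib[symmetric]) auto
        also have "\<dots> = Factorial_Ring.multiplicity p A + 2 * Factorial_Ring.multiplicity p y"
          using A \<open>y \<noteq> 0\<close> unfolding y[symmetric]
          by (intro multiplicity_times_square p(1))
        finally show ?thesis using not_dvd_imp_multiplicity_0[OF p(2)] by simp
      qed (simp add: not_dvd_imp_multiplicity_0)
    qed
    then show ?thesis using i pos[OF i(1)] by (auto simp: T_set_def)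
  qed
  then show ?thesis
    using cop unfolding is_coprimality_clique_def clique_def coprimality_edges_def
    by (intro conjI subsetI ballI impI) (auto, metis)
qed

lemma square_product_iff:
  assumes A: "A \<noteq> 0" and I: "finite I" and pos: "\<And>i. i \<in> I \<Longrightarrow> n i > 0"
  shows "(\<exists>y. A * y\<^sup>2 = (\<Prod>i\<in>I. lucas_U P Q (n i))) \<longleftrightarrow>
    finprod sqclass_group (\<lambda>i. sqclass (of_int (lucas_U P Q (n i)))) I = sqclass (of_int A) \<and>
    (\<forall>p::int. Factorial_Ring.prime p \<longrightarrow>
       (\<exists>k::nat. (\<Sum>i\<in>I. int (Factorial_Ring.multiplicity p (lucas_U P Q (n i))))
          - int (Factorial_Ring.multiplicity p A) = 2 * int k))"
proof -
  let ?U = "\<lambda>i. lucas_U P Q (n i)"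
  define N where "N = (\<Prod>i\<in>I. ?U i)"
  have nz: "?U i \<noteq> 0" if "i \<in> I" for i using lucas_U_nonzero pos that by blast
  have N: "N \<noteq> 0" unfolding N_def using nz I by simp
  have "finprod sqclass_group (\<lambda>i. sqclass (of_int (?U i))) I = sqclass (\<Prod>i\<in>I. rat_of_int (?U i))"
    using nz I by (intro finprod_sqclass) auto
  also have "(\<Prod>i\<in>I. rat_of_int (?U i)) = of_int N" by (simp add: N_def)
  finally have fp: "finprod sqclass_group (\<lambda>i. sqclass (of_int (?U i))) I = sqclass (of_int N)" .
  have val: "(\<Sum>i\<in>I. int (Factorial_Ring.multiplicity p (?U i))) = int (Factorial_Ring.multiplicity p N)"
    if "Factorial_Ring.prime p" for p
    using that I nz unfolding N_def 
    by (subst prime_elem_multiplicity_prod_distrib) auto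
  show ?thesis
    unfolding fp N_def[symmetric]
  proof (intro iffI conjI allI impI)
    assume "\<exists>y. A * y\<^sup>2 = N"
    then obtain y where y: "A * y\<^sup>2 = N" by blast
    have y0: "y \<noteq> 0" using N y by auto
    show "sqclass (of_int N) = sqclass (of_int A)"
      using N A y0 by (subst sqclass_eq_iff) (auto intro!: exI[of _ "of_int y"] simp flip: y)
    fix p :: int assume p: "Factorial_Ring.prime p"
    have "Factorial_Ring.multiplicity p N = Factorial_Ring.multiplicity p A + 2 * Factorial_Ring.multiplicity p y"
      using A y0 unfolding y[symmetric] by (intro multiplicity_times_square p)
    then show "\<exists>k::nat. (\<Sum>i\<in>I. int (Factorial_Ring.multiplicity p (?U i)))
          - int (Factorial_Ring.multiplicity p A) = 2 * int k"
      unfolding val[OF p] by (intro exI[of _ "Factorial_Ring.multiplicity p y"]) simp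
  next
    assume *: "sqclass (of_int N) = sqclass (of_int A) \<and> (\<forall>p::int. Factorial_Ring.prime p \<longrightarrow>
       (\<exists>k::nat. (\<Sum>i\<in>I. int (Factorial_Ring.multiplicity p (?U i)))
          - int (Factorial_Ring.multiplicity p A) = 2 * int k))"
    then obtain q :: rat where q: "of_int N = q\<^sup>2 * of_int A" using N A by (auto simp: sqclass_eq_iff)
    have "A dvd N"
    proof (rule multiplicity_le_imp_dvd[OF A])
      fix p :: int assume p: "Factorial_Ring.prime p"
      then obtain k :: nat where "int (Factorial_Ring.multiplicity p N) - int (Factorial_Ring.multiplicity p A) = 2 * int k"
        using * val by metis
      then show "Factorial_Ring.multiplicity p A \<le> Factorial_Ring.multiplicity p N" by linarith
    qed
    then obtain t where t: "N = A * t" by blast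
    then have "q\<^sup>2 = of_int t" using q A by simp
    then obtain y where "q = of_int y" by (rule rat_square_int_imp_int)
    then have "of_int (y\<^sup>2) = (of_int t :: rat)" using \<open>q\<^sup>2 = of_int t\<close> by simp
    then have "y\<^sup>2 = t" by (simp only: of_int_eq_iff)
    then show "\<exists>y. A * y\<^sup>2 = N" using t by blast
  qed
qed

end

theorem corollary1p4:
  fixes P Q A :: int
  assumes "Q = 1 \<or> Q = -1"
    and "P\<^sup>2 + 4 * Q > 0"
    and "lucas_nondegenerate P Q"
    and "abc_conjecture (quadratic_field (P\<^sup>2 + 4 * Q))"
    and "A \<noteq> 0"
  shows "finite (T_set P Q A) \<and>
    (\<forall>r::nat. r \<ge> 1 \<longrightarrow> (\<forall>n :: nat \<Rightarrow> nat.
           (\<forall>i\<in>{1..r}. n i > 0) \<longrightarrow>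
           (\<forall>i\<in>{1..r}. \<forall>j\<in>{1..r}. i \<noteq> j \<longrightarrow> gcd (n i) (n j) = 1) \<longrightarrow>
           (\<exists>y::int. A * y\<^sup>2 = (\<Prod>i=1..r. lucas_U P Q (n i))) \<longrightarrow>
           is_coprimality_clique (T_set P Q A) {n i | i. i \<in> {1..r} \<and> n i \<noteq> 1})) \<and>
    (\<forall>r::nat. r \<ge> 1 \<longrightarrow> (\<forall>n :: nat \<Rightarrow> nat.
           (\<forall>i\<in>{1..r}. n i > 0) \<longrightarrow>
           (\<forall>i\<in>{1..r}. \<forall>j\<in>{1..r}. i \<noteq> j \<longrightarrow> gcd (n i) (n j) = 1) \<longrightarrow>
           is_coprimality_clique (T_set P Q A) {n i | i. i \<in> {1..r} \<and> n i \<noteq> 1} \<longrightarrow>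
           ((\<exists>y::int. A * y\<^sup>2 = (\<Prod>i=1..r. lucas_U P Q (n i))) \<longleftrightarrow>
              finprod sqclass_group (\<lambda>i. sqclass (of_int (lucas_U P Q (n i)))) {1..r}
                = sqclass (of_int A) \<and>
              (\<forall>p::int. Factorial_Ring.prime p \<longrightarrow>
                 (\<exists>k::nat. (\<Sum>i=1..r. int (Factorial_Ring.multiplicity p (lucas_U P Q (n i))))
                             - int (Factorial_Ring.multiplicity p A) = 2 * int k)))))"
proof -
  interpret real_lucas P Q
    using assms(1,2) nondegenerate_imp_P_nonzero[OF assms(1-3)] by unfold_locales
  show ?thesis
  proof (intro conjI allI impI, goal_cases)
    case 1
    show ?case using assms(4,5) by (rule finite_T_set)
  next
    case (2 r n)
    then show ?case
      using square_product_imp_clique[OF assms(5), of "{1..r}" n] by (auto simp: coprime_iff_gcd_eq_1)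
  next
    case (3 r n)
    then show ?case by (intro square_product_iff assms(5)) auto
  qed
qed

end
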